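(* Let $\mathcal{A}$ be a simple, pairwise intersecting arrangement of $n$ pseudocircles on the sphere such that there is a pseudocircle $C\in\mathcal{A}$ with the following property: for any two pseudocircles $C',C''\in\mathcal{A}$ distinct from $C$, the two intersection points of $C'\cap C''$ lie in different components of the complement of $C$. Then $\mathcal{A}$ has at least $2n$ triangles.
   Context: A pseudocircle is a simple closed curve on the sphere. An arrangement of pseudocircles is a finite collection of pseudocircles such that any two are either disjoint or intersect in exactly two points, at which they cross; it is simple if no three pseudocircles share a point, and pairwise intersecting if every two pseudocircles intersect. A triangle is a cell of the induced decomposition of the sphere with exactly $3$ crossings on its boundary.
   Formalization: The formal theorem assumes n ≥ 3; as stated the claim fails for n = 1 (one pseudocircle, no triangles) and n = 2 (two crossing pseudocircles give four digons and no triangles). *)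

theory Defs
  imports "HOL-Analysis.Analysis"
begin

definition S2 :: "(real^3) set" where
  "S2 = sphere 0 1"

definition pseudocircle :: "(real^3) set \<Rightarrow> bool" where
  "pseudocircle C \<longleftrightarrow> (\<exists>g. simple_path g \<and> pathfinish g = pathstart g \<and>
       path_image g \<subseteq> S2 \<and> path_image g = C)"

definition crosses_at :: "(real^3) set \<Rightarrow> (real^3) set \<Rightarrow> real^3 \<Rightarrow> bool" where
  "crosses_at C D p \<longleftrightarrow> (\<forall>e>0. \<exists>x\<in>D \<inter> ball p e. \<exists>y\<in>D \<inter> ball p e.
       \<exists>U\<in>components (S2 - C). \<exists>W\<in>components (S2 - C). U \<noteq> W \<and> x \<in> U \<and> y \<in> W)"

definition arrangement :: "(real^3) set set \<Rightarrow> bool" where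
  "arrangement A \<longleftrightarrow> finite A \<and> (\<forall>C\<in>A. pseudocircle C) \<and>
     (\<forall>C\<in>A. \<forall>D\<in>A. C \<noteq> D \<longrightarrow>
        C \<inter> D = {} \<or>
        (card (C \<inter> D) = 2 \<and> (\<forall>p\<in>C \<inter> D. crosses_at C D p \<and> crosses_at D C p)))"

definition simple_arrangement :: "(real^3) set set \<Rightarrow> bool" where
  "simple_arrangement A \<longleftrightarrow> arrangement A \<and>
     (\<forall>C\<in>A. \<forall>D\<in>A. \<forall>E\<in>A. C \<noteq> D \<and> C \<noteq> E \<and> D \<noteq> E \<longrightarrow> C \<inter> D \<inter> E = {})"

definition pairwise_intersecting :: "(real^3) set set \<Rightarrow> bool" where
  "pairwise_intersecting A \<longleftrightarrow> (\<forall>C\<in>A. \<forall>D\<in>A. C \<noteq> D \<longrightarrow> C \<inter> D \<noteq> {})"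

definition crossings :: "(real^3) set set \<Rightarrow> (real^3) set" where
  "crossings A = {p. \<exists>C\<in>A. \<exists>D\<in>A. C \<noteq> D \<and> p \<in> C \<and> p \<in> D}"

definition cells :: "(real^3) set set \<Rightarrow> (real^3) set set" where
  "cells A = components (S2 - \<Union>A)"

definition triangles :: "(real^3) set set \<Rightarrow> (real^3) set set" where
  "triangles A = {F \<in> cells A. card (closure F \<inter> crossings A) = 3}"

end

theory Submission
  imports Defs
begin

text \<open>
  Each side \<open>U\<close> of \<open>C\<close> is a disc in which every other pseudocircle is a single chord and any two
  chords cross exactly once. Recording the sides of the curves on which the crossings of \<open>U\<close> lie
  therefore gives a uniform rank 3 chirotope whose ground set is the whole arrangement, with \<open>C\<close>
  as line at infinity. By Levi's argument every line of a uniform chirotope on \<open>n \<ge> 4\<close> elements is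
  adjacent to at least three empty triangles, so there are at least \<open>n\<close> of them.

  An empty triangle is realised by a cell: its three edges meet no other curve in their interior,
  so they form a Jordan curve \<open>J\<close>, and the part of the arrangement outside \<open>J\<close> is connected because
  the curves intersect pairwise. Hence one of the two components of \<open>S2 - J\<close> is a cell.
  The cells obtained from the two sides of \<open>C\<close> are distinct, which gives \<open>2 * n\<close> triangles.

  Since \<open>card\<close> of an infinite set is \<open>0\<close>, finiteness of the set of cells is part of the claim;
  by Janiszewski's theorem a cell is determined by the sides of the curves on which it lies.
\<close>

text \<open>A side \<open>U\<close> of \<open>C\<close> plays the affine part of a projective plane:
  the two ends of a chord on \<open>C\<close> stand for one point at infinity. The chords need not
  be stretchable to straight lines, so determinants are replaced by signs. What topology supplies to
  the chirotope is that arcs of one curve meet another curve once and change sides there.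

  Levi's argument looks at the \<open>2 * m\<close> ends, along a line \<open>l\<close>, of the
  \<open>m\<close> other lines. Among any \<open>m\<close> consecutive gaps between ends, one is cut
  off by a triangle: follow, for each line, the partner of its last crossing. Partners point to the
  right for the leftmost line and to the left for the rightmost one, and where the direction
  switches, two neighbours are partners of each other. Opposite gaps never both carry a triangle, so
  overlapping windows yield three of them. Summing over \<open>l\<close> counts every triangle three
  times.

  Three lines determine their empty triangle only in the presence of a fourth line. For
  \<open>n = 3\<close> all four triangles of a side have the same three lines, and this case is
  counted directly.\<close>

section \<open>Empty triangles of uniform rank 3 chirotopes\<close>

text \<open>On line \<open>i\<close> the crossing with \<open>j\<close> precedes the crossing with \<open>k\<close>; here \<open>X\<close> is normalised so
  that the line at infinity sees the lines in the order of their indices.\<close>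

definition before :: "(nat \<Rightarrow> nat \<Rightarrow> nat \<Rightarrow> int) \<Rightarrow> nat \<Rightarrow> nat \<Rightarrow> nat \<Rightarrow> bool" where
  "before X i j k \<longleftrightarrow> X i j k = (if (j < i) = (k < i) then 1 else - 1)"

text \<open>Both alternatives describe two neighbours in the order at infinity whose crossing is
  extremal on each of them. In the first it is last on \<open>i\<close> and on \<open>Suc i\<close>.
  In the second the neighbours are \<open>m - 1\<close> and \<open>0\<close>, where the order closes
  up with reversed orientation, so the crossing is last on \<open>m - 1\<close> and first on
  \<open>0\<close>.\<close>

lemma extremal_adjacent_pair:
  fixes X :: "nat \<Rightarrow> nat \<Rightarrow> nat \<Rightarrow> int"
  assumes m: "m \<ge> 3"
    and val: "\<And>i j k. \<lbrakk>i < m; j < m; k < m; i \<noteq> j; i \<noteq> k; j \<noteq> k\<rbrakk> \<Longrightarrow> X i j k = 1 \<or> X i j k = - 1"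
    and sw1: "\<And>i j k. \<lbrakk>i < m; j < m; k < m; i \<noteq> j; i \<noteq> k; j \<noteq> k\<rbrakk> \<Longrightarrow> X j i k = - X i j k"
    and sw2: "\<And>i j k. \<lbrakk>i < m; j < m; k < m; i \<noteq> j; i \<noteq> k; j \<noteq> k\<rbrakk> \<Longrightarrow> X i k j = - X i j k"
    and tr: "\<And>i j k h. \<lbrakk>i < m; j < m; k < m; h < m; distinct [i, j, k, h];
               before X i j k; before X i k h\<rbrakk> \<Longrightarrow> before X i j h"
  shows "(\<exists>i. Suc i < m \<and> (\<forall>k. Suc i < k \<and> k < m \<longrightarrow> X i (Suc i) k = - 1) \<and>
             (\<forall>k<i. X k i (Suc i) = 1)) \<or>
         (\<forall>k. 0 < k \<and> Suc k < m \<longrightarrow> X 0 k (m - 1) = - 1)"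
proof -
  have tot: "before X i j k \<or> before X i k j"
    and asym: "\<not> (before X i j k \<and> before X i k j)"
    if "i < m" "j < m" "k < m" "i \<noteq> j" "i \<noteq> k" "j \<noteq> k" for i j k
    using val[OF that] sw2[OF that] that by (auto simp: before_def split: if_splits)
  have bX: "before X i j k \<longleftrightarrow> X i j k = 1" "before X j i k \<longleftrightarrow> X i j k = 1"
     "before X k i j \<longleftrightarrow> X i j k = 1"
    if "i < j" "j < k" "k < m" for i j k
  proof -
    have a: "i < m" "j < m" "k < m" "i \<noteq> j" "i \<noteq> k" "j \<noteq> k" using that by auto
    have "X k i j = - X i k j" using sw1[of i k j] a by blast
    moreover have "X i k j = - X i j k" using sw2[of i j k] a by blast
    ultimately have "X k i j = X i j k" by simp
    then show "before X i j k \<longleftrightarrow> X i j k = 1" "before X j i k \<longleftrightarrow> X i j k = 1"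
     "before X k i j \<longleftrightarrow> X i j k = 1"
      using that sw1[OF a] by (auto simp: before_def)
  qed
  have bX': "before X i k j \<longleftrightarrow> X i j k = - 1" "before X j k i \<longleftrightarrow> X i j k = - 1"
     "before X k j i \<longleftrightarrow> X i j k = - 1"
    if "i < j" "j < k" "k < m" for i j k
    using bX[OF that] that tot[of i j k] tot[of j i k] tot[of k i j]
      asym[of i j k] asym[of j i k] asym[of k i j] val[of i j k] by auto
  \<comment> \<open>\<open>f\<close> is the line crossed last on line \<open>i\<close>, a maximum of
    the total order \<open>before X i\<close>.\<close>
  have "\<exists>f. f < m \<and> f \<noteq> i \<and> (\<forall>k<m. k \<noteq> i \<and> k \<noteq> f \<longrightarrow> before X i k f)" if i: "i < m" for i
  proof -
    let ?R = "\<lambda>j k. j < m \<and> k < m \<and> j \<noteq> i \<and> k \<noteq> i \<and> j \<noteq> k \<and> before X i j k"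
    let ?A = "{..<m} - {i}"
    have fin: "finite ?A" by simp
    have as: "asymp_on ?A ?R"
      using asym i by (auto simp: asymp_on_def)
    have trs: "transp_on ?A ?R"
    proof (rule transp_onI)
      fix x y z assume "?R x y" "?R y z"
      moreover have "x \<noteq> z" using calculation asym[of i x y] i by auto
      ultimately show "?R x z" using tr[of i x y z] i by auto
    qed
    have "(if i = 0 then 1 else 0) \<in> ?A" using m i by auto
    then have ne: "?A \<noteq> {}" by blast
    obtain f where f: "f \<in> ?A" "\<forall>x\<in>?A. x \<noteq> f \<longrightarrow> \<not> ?R f x"
      using Finite_Set.bex_max_element[OF fin as trs ne] by blast
    have "before X i k f" if "k < m" "k \<noteq> i" "k \<noteq> f" for k
      using tot[of i k f] f that i by auto
    then show ?thesis using f by auto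
  qed
  then obtain f where f: "\<And>i. i < m \<Longrightarrow> f i < m" "\<And>i. i < m \<Longrightarrow> f i \<noteq> i"
     "\<And>i k. \<lbrakk>i < m; k < m; k \<noteq> i; k \<noteq> f i\<rbrakk> \<Longrightarrow> before X i k (f i)"
    by metis
  consider (zero) "f 1 = 0" | (last) "f 1 \<noteq> 0" "f (m - 1) = 0"
    | (mid) "f 1 \<noteq> 0" "f (m - 1) \<noteq> 0" by blast
  then show ?thesis
  proof cases
    case zero
    have "X 0 1 k = - 1" if "1 < k" "k < m" for k
      using f(3)[of 1 k] zero bX'(2)[of 0 1 k] that by auto
    then show ?thesis using m by (intro disjI1 exI[of _ 0]) auto
  next
    case last
    have "X 0 k (m - 1) = - 1" if "0 < k" "Suc k < m" for k
      using f(3)[of "m - 1" k] last bX'(3)[of 0 k "m - 1"] that by auto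
    then show ?thesis by auto
  next
    case mid
    define Q where "Q i \<longleftrightarrow> i < f i" for i
    have 1: "Q 1" using mid(1) f(2)[of 1] m unfolding Q_def by linarith
    have m1: "\<not> Q (m - 1)" using f(1)[of "m - 1"] m unfolding Q_def by linarith
    \<comment> \<open>Discrete intermediate value argument: the last crossing on line
      \<open>1\<close> is with a later line, the one on line \<open>m - 1\<close> with an earlier
      line. A switch between \<open>0\<close> and \<open>1\<close> was the case
      \<open>zero\<close>.\<close>
    have "\<exists>i. 1 \<le> i \<and> Suc i < m \<and> Q i \<and> \<not> Q (Suc i)"
    proof (rule ccontr)
      assume "\<not> ?thesis"
      then have *: "\<And>i. 1 \<le> i \<Longrightarrow> Suc i < m \<Longrightarrow> Q i \<Longrightarrow> Q (Suc i)" by blast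
      have "i < m \<longrightarrow> Q i" if "1 \<le> i" for i
        using that by (induction i rule: dec_induct) (use 1 * in auto)
      then show False using m1 m by auto
    qed
    then obtain i where i: "1 \<le> i" "Suc i < m" "i < f i" "f (Suc i) < Suc i"
      unfolding Q_def using f(2) by (meson linorder_neqE_nat)
    define j where "j = f i"
    define j' where "j' = f (Suc i)"
    have j: "i < j" "j < m" and j': "j' \<le> i"
      using i f(1) unfolding j_def j'_def by auto
    have Li: "before X i k j" if "k < m" "k \<noteq> i" "k \<noteq> j" for k
      using f(3) that i unfolding j_def by auto
    have Li': "before X (Suc i) k j'" if "k < m" "k \<noteq> Suc i" "k \<noteq> j'" for k
      using f(3) that i unfolding j'_def by auto
    \<comment> \<open>Otherwise the known last crossings on \<open>i\<close> and
      \<open>Suc i\<close> force a cycle on line \<open>j'\<close>: \<open>Suc i\<close> before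
      \<open>i\<close>, \<open>i\<close> before \<open>j\<close>, and \<open>j\<close> before
      \<open>Suc i\<close>.\<close>
    have jj: "j = Suc i"
    proof (rule ccontr)
      assume "j \<noteq> Suc i"
      then have ij: "Suc i < j" using j by auto
      have c1: "X i (Suc i) j = 1" using Li[of "Suc i"] bX(1)[of i "Suc i" j] ij j by auto
      have "before X (Suc i) i j" using bX(2)[of i "Suc i" j] c1 ij j by auto
      then have "j' \<noteq> i" using Li'[of j] asym[of "Suc i" i j] ij j by auto
      then have j'i: "j' < i" using j' by auto
      have c2: "X j' (Suc i) j = - 1" using Li'[of j] bX'(2)[of j' "Suc i" j] ij j j'i by auto
      have c3: "X j' i j = 1" using Li[of j'] bX(2)[of j' i j] ij j j'i by auto
      have c4: "X j' i (Suc i) = - 1" using Li'[of i] bX'(3)[of j' i "Suc i"] i j'i by auto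
      have d1: "before X j' (Suc i) i" using c4 bX'(1)[of j' i "Suc i"] i j'i by auto
      have d2: "before X j' i j" using c3 bX(1)[of j' i j] j j'i by auto
      have d3: "before X j' j (Suc i)" using c2 bX'(1)[of j' "Suc i" j] j ij j'i by auto
      have "before X j' (Suc i) j" using tr[OF _ _ _ _ _ d1 d2] ij j j'i by auto
      then show False using d3 asym[of j' "Suc i" j] ij j j'i by auto
    qed
    have jj': "j' = i"
    proof (rule ccontr)
      assume "j' \<noteq> i"
      then have j'i: "j' < i" using j' by auto
      have "X j' i (Suc i) = 1" using Li[of j'] jj bX(2)[of j' i "Suc i"] i j'i by auto
      moreover have "X j' i (Suc i) = - 1" using Li'[of i] bX'(3)[of j' i "Suc i"] i j'i by auto
      ultimately show False by simp
    qed
    have "X i (Suc i) k = - 1" if "Suc i < k" "k < m" for k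
      using Li[of k] jj bX'(1)[of i "Suc i" k] that by auto
    moreover have "X k i (Suc i) = 1" if "k < i" for k
      using Li[of k] jj bX(2)[of k i "Suc i"] that i by auto
    ultimately show ?thesis using i by blast
  qed
qed

section \<open>Uniform chirotopes and Levi's count of the triangles at a line\<close>

lemma linear_order_enumeration:
  assumes "finite A"
    and asym: "\<And>x y. \<lbrakk>x \<in> A; y \<in> A; R x y\<rbrakk> \<Longrightarrow> \<not> R y x"
    and tot: "\<And>x y. \<lbrakk>x \<in> A; y \<in> A; x \<noteq> y\<rbrakk> \<Longrightarrow> R x y \<or> R y x"
    and tr: "\<And>x y z. \<lbrakk>x \<in> A; y \<in> A; z \<in> A; R x y; R y z\<rbrakk> \<Longrightarrow> R x z"
  shows "\<exists>xs. set xs = A \<and> distinct xs \<and> sorted_wrt R xs"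
  using assms
proof (induction "card A" arbitrary: A)
  case 0
  have "A = {}" using 0(1,2) by simp
  then show ?case by (intro exI[of _ "[]"]) simp
next
  case (Suc n)
  have ne: "A \<noteq> {}" using Suc.hyps(2) by auto
  have as: "asymp_on A R" by (intro asymp_onI) (rule Suc.prems(2))
  have trs: "transp_on A R" by (intro transp_onI) (rule Suc.prems(4))
  obtain a where a: "a \<in> A" "\<forall>x\<in>A. x \<noteq> a \<longrightarrow> \<not> R x a"
    using Finite_Set.bex_min_element[OF Suc.prems(1) as trs ne] by blast
  have n: "n = card (A - {a})" using Suc.hyps(2) a Suc.prems(1) by simp
  have "\<exists>xs. set xs = A - {a} \<and> distinct xs \<and> sorted_wrt R xs"
  proof (rule Suc.hyps(1)[OF n])
    show "finite (A - {a})" using Suc.prems(1) by simp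
    show "\<not> R y x" if "x \<in> A - {a}" "y \<in> A - {a}" "R x y" for x y
      using Suc.prems(2) that by blast
    show "R x y \<or> R y x" if "x \<in> A - {a}" "y \<in> A - {a}" "x \<noteq> y" for x y
      using Suc.prems(3) that by blast
    show "R x z" if "x \<in> A - {a}" "y \<in> A - {a}" "z \<in> A - {a}" "R x y" "R y z" for x y z
      using that by (intro Suc.prems(4)[of x y z]) simp_all
  qed
  then obtain xs where "set xs = A - {a}" "distinct xs" "sorted_wrt R xs" by blast
  moreover have "R a x" if "x \<in> A - {a}" for x
    using a Suc.prems(3)[of a x] that by blast
  ultimately show ?case using a(1) by (intro exI[of _ "a # xs"]) auto
qed

text \<open>The last axiom is the sign form of the three-term relation
  \<open>[abc][ade] + [abd][aec] + [abe][acd] = 0\<close>: three nonzero terms with sum zero cannot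
  all have the same sign.\<close>

locale chirotope =
  fixes E :: "'a set" and chi :: "'a \<Rightarrow> 'a \<Rightarrow> 'a \<Rightarrow> int"
  assumes finite_ground: "finite E"
    and chi_values: "\<lbrakk>a \<in> E; b \<in> E; c \<in> E; distinct [a, b, c]\<rbrakk> \<Longrightarrow> chi a b c = 1 \<or> chi a b c = - 1"
    and chi_swap12: "\<lbrakk>a \<in> E; b \<in> E; c \<in> E; distinct [a, b, c]\<rbrakk> \<Longrightarrow> chi b a c = - chi a b c"
    and chi_swap23: "\<lbrakk>a \<in> E; b \<in> E; c \<in> E; distinct [a, b, c]\<rbrakk> \<Longrightarrow> chi a c b = - chi a b c"
    and chi_grassmann_pluecker:
      "\<lbrakk>a \<in> E; b \<in> E; c \<in> E; d \<in> E; e \<in> E; distinct [a, b, c, d, e]\<rbrakk> \<Longrightarrow>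
         \<not> (chi a b c * chi a d e = chi a b d * chi a e c \<and>
            chi a b d * chi a e c = chi a b e * chi a c d)"
begin

text \<open>\<open>chi b c d\<close>, \<open>chi c a d\<close> and \<open>chi a b d\<close> are the
  signs of \<open>d\<close> at the three vertices, and a product of two of them does not change when
  \<open>d\<close> is reversed. The lines \<open>a\<close>, \<open>b\<close>, \<open>c\<close> cut
  the projective plane into four triangles, one for each sign pattern up to reversal, and a further
  line misses exactly the one belonging to its pattern. So the condition says that all other lines
  miss the same triangle.\<close>

definition empty_triangle :: "'a \<Rightarrow> 'a \<Rightarrow> 'a \<Rightarrow> bool" where
  "empty_triangle a b c \<longleftrightarrow> (\<forall>d\<in>E - {a, b, c}. \<forall>e\<in>E - {a, b, c}.
      chi b c d * chi c a d = chi b c e * chi c a e \<and>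
      chi c a d * chi a b d = chi c a e * chi a b e)"

definition empty_triangles :: "'a set set" where
  "empty_triangles = {{a, b, c} | a b c. a \<in> E \<and> b \<in> E \<and> c \<in> E \<and> distinct [a, b, c] \<and> empty_triangle a b c}"

text \<open>With \<open>l\<close> fixed, \<open>chi l\<close> is a rank 2 chirotope. The signs
  \<open>ep\<close> reorient its elements so that an arbitrary \<open>r\<close> precedes all others;
  the Grassmann-Pluecker relation at \<open>l\<close> that involves \<open>r\<close> then rules out
  cyclic triples.\<close>

lemma line_enumeration:
  assumes l: "l \<in> E" and ne: "E - {l} \<noteq> {}"
  obtains xs ep where "set xs = E - {l}" "distinct xs"
    "\<And>b. b \<in> E - {l} \<Longrightarrow> ep b = 1 \<or> ep b = (- 1 :: int)"
    "\<And>i j. \<lbrakk>i < j; j < length xs\<rbrakk> \<Longrightarrow> ep (xs ! i) * ep (xs ! j) * chi l (xs ! i) (xs ! j) = 1"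
proof -
  obtain r where r: "r \<in> E - {l}" using ne by blast
  define ep where "ep b = (if b = r then 1 else chi l r b)" for b
  have ep: "ep b = 1 \<or> ep b = - 1" if "b \<in> E - {l}" for b
    using that r l chi_values[of l r b] by (auto simp: ep_def)
  define R where "R b c \<longleftrightarrow> b \<noteq> c \<and> ep b * ep c * chi l b c = 1" for b c
  have sw: "chi l c b = - chi l b c" if "b \<in> E - {l}" "c \<in> E - {l}" "b \<noteq> c" for b c
    using chi_swap23[of l b c] that l by auto
  have vl: "chi l b c = 1 \<or> chi l b c = - 1" if "b \<in> E - {l}" "c \<in> E - {l}" "b \<noteq> c" for b c
    using chi_values[of l b c] that l by auto
  have asym: "\<not> R c b" if "b \<in> E - {l}" "c \<in> E - {l}" "R b c" for b c
    using that sw[of b c] unfolding R_def by (auto simp: mult.commute)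
  have tot: "R b c \<or> R c b" if "b \<in> E - {l}" "c \<in> E - {l}" "b \<noteq> c" for b c
    using that sw[of b c] vl[of b c] ep[of b] ep[of c] unfolding R_def by auto
  have rmin: "R r b" if "b \<in> E - {l}" "b \<noteq> r" for b
    using that vl[of r b] r unfolding R_def ep_def by auto
  have tr: "R b d" if b: "b \<in> E - {l}" and c: "c \<in> E - {l}" and d: "d \<in> E - {l}"
    and bc: "R b c" and cd: "R c d" for b c d
  proof -
    have ne: "b \<noteq> c" "c \<noteq> d" using bc cd unfolding R_def by auto
    have bd: "b \<noteq> d" using asym[OF b c bc] cd by auto
    show ?thesis
    proof (cases "b = r")
      case True then show ?thesis using rmin[of d] bd d by auto
    next
      case br: False
      have cr: "c \<noteq> r" using asym[OF b c bc] rmin[of b] br b by auto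
      have dr: "d \<noteq> r" using asym[OF c d cd] rmin[of c] cr c by auto
      have G: "\<not> (chi l r b * chi l c d = chi l r c * chi l d b \<and>
            chi l r c * chi l d b = chi l r d * chi l b c)"
        using chi_grassmann_pluecker[of l r b c d] l r b c d br cr dr ne bd by auto
      show ?thesis
      proof (rule ccontr)
        assume "\<not> R b d"
        then have "R d b" using tot[OF b d bd] by blast
        then show False
          using G bc cd ep[OF b] ep[OF c] ep[OF d] br cr dr unfolding R_def ep_def by auto
      qed
    qed
  qed
  have "\<exists>xs. set xs = E - {l} \<and> distinct xs \<and> sorted_wrt R xs"
    by (rule linear_order_enumeration) (use finite_ground asym tot tr in blast)+
  then obtain xs where xs: "set xs = E - {l}" "distinct xs" "sorted_wrt R xs" by blast
  show ?thesis
  proof (rule that[OF xs(1,2) ep])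
    fix i j assume "i < j" "j < length xs"
    then show "ep (xs ! i) * ep (xs ! j) * chi l (xs ! i) (xs ! j) = 1"
      using sorted_wrt_nth_less[OF xs(3)] unfolding R_def by blast
  qed
qed

text \<open>Viewed from the line \<open>l\<close> at infinity, the other lines are indexed periodically by the
  naturals, each period reversing their orientation; \<open>B t\<close> and \<open>B (t + m)\<close> are thus the two
  ends of one line. An empty triangle adjacent to \<open>l\<close> lies between consecutive ends.\<close>

lemma three_empty_triangles_at_line:
  assumes l: "l \<in> E" and card: "card E \<ge> 4"
  shows "card {S \<in> empty_triangles. l \<in> S} \<ge> 3"
proof -
  have cE: "card (E - {l}) \<ge> 3" using card l finite_ground by simp
  then have "E - {l} \<noteq> {}" by (metis card.empty not_numeral_le_zero)
  then obtain xs ep where xs: "set xs = E - {l}" "distinct xs"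
    and ep: "\<And>b. b \<in> E - {l} \<Longrightarrow> ep b = 1 \<or> ep b = (- 1 :: int)"
    and srt: "\<And>i j. \<lbrakk>i < j; j < length xs\<rbrakk> \<Longrightarrow> ep (xs ! i) * ep (xs ! j) * chi l (xs ! i) (xs ! j) = 1"
    using line_enumeration[OF l] by metis
  define m where "m = length xs"
  have m: "m \<ge> 3" using cE xs distinct_card[OF xs(2)] unfolding m_def by simp
  define B where "B t = xs ! (t mod m)" for t
  define e where "e t = ep (B t) * (- 1) ^ (t div m)" for t
  define X where "X s t u = e s * e t * e u * chi (B s) (B t) (B u)" for s t u
  \<comment> \<open>The crossing of the neighbouring ends \<open>t\<close> and \<open>t + 1\<close>
    is extremal on both lines, so that it spans an empty triangle with \<open>l\<close>. The range
    of \<open>u\<close> meets every remaining line exactly once.\<close>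
  define P where "P t \<longleftrightarrow> (\<forall>u. t + 1 < u \<and> u < t + m \<longrightarrow> X t (t + 1) u = - 1)" for t
  have BE: "B t \<in> E - {l}" for t
    using m xs(1) unfolding B_def m_def by (metis mod_less_divisor nth_mem zero_less_numeral less_le_trans)
  have Beq: "B s = B t \<longleftrightarrow> s mod m = t mod m" for s t
    using m xs(2) nth_eq_iff_index_eq[of xs "s mod m" "t mod m"] unfolding B_def m_def
    by (metis mod_less_divisor less_le_trans zero_less_numeral)
  have e: "e t = 1 \<or> e t = - 1" for t
    using ep[OF BE[of t]] unfolding e_def by (cases "even (t div m)") auto
  have Bper: "B (t + m) = B t" for t unfolding B_def by simp
  have eper: "e (t + m) = - e t" for t using m unfolding e_def Bper by simp
  have modne: "s mod m \<noteq> t mod m" if "s < t" "t < s + m" for s t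
  proof
    assume "s mod m = t mod m"
    then have "m dvd t - s" using that by (metis less_imp_le mod_eq_dvd_iff_nat)
    moreover have "0 < t - s" "t - s < m" using that by auto
    ultimately show False using nat_dvd_not_less by blast
  qed
  \<comment> \<open>Any \<open>m\<close> consecutive ends are linearly ordered at infinity: when
    \<open>t\<close> falls into the next period, the extra sign in \<open>e t\<close> makes up for
    the exchange of the two indices.\<close>
  have Y: "e s * e t * chi l (B s) (B t) = 1" if st: "s < t" "t < s + m" for s t
  proof -
    define i q where "i = s mod m" and "q = s div m"
    have s: "s = q * m + i" and im: "i < m" unfolding i_def q_def using m by auto
    define j where "j = t - q * m"
    have t: "t = q * m + j" "i < j" "j < i + m" using st s unfolding j_def by auto
    have Bs: "B s = xs ! i" unfolding B_def i_def ..
    have es: "e s = ep (xs ! i) * (- 1) ^ q" unfolding e_def Bs q_def ..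
    show ?thesis
    proof (cases "j < m")
      case True
      then have tm: "t mod m = j" "t div m = q" using t m by auto
      have Bt: "B t = xs ! j" unfolding B_def tm ..
      have et: "e t = ep (xs ! j) * (- 1) ^ q" unfolding e_def Bt tm ..
      have "e s * e t * chi l (B s) (B t) =
          ((- 1) ^ q * (- 1) ^ q) * (ep (xs ! i) * ep (xs ! j) * chi l (xs ! i) (xs ! j))"
        unfolding es et Bs Bt by (simp only: mult_ac)
      also have "((- 1) ^ q * (- 1) ^ q :: int) = 1" by (simp flip: power_add)
      finally show ?thesis using srt[of i j] True t(2) unfolding m_def by simp
    next
      case False
      define j' where "j' = j - m"
      have j': "j' < i" "t = Suc q * m + j'" using t False unfolding j'_def by auto
      then have tm: "t mod m = j'" "t div m = Suc q" using im by (simp_all only: mod_mult_self3 div_mult_self3) auto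
      have Bt: "B t = xs ! j'" unfolding B_def tm ..
      have et: "e t = - (ep (xs ! j') * (- 1) ^ q)" unfolding e_def Bt tm by simp
      have sw: "chi l (xs ! i) (xs ! j') = - chi l (xs ! j') (xs ! i)"
        using chi_swap23[of l "xs ! j'" "xs ! i"] xs l j' im unfolding m_def
        by (metis DiffE distinct_length_2_or_more distinct_singleton insertI1 nat_neq_iff nth_eq_iff_index_eq nth_mem order_less_trans)
      have "e s * e t * chi l (B s) (B t) =
          ((- 1) ^ q * (- 1) ^ q) * (ep (xs ! j') * ep (xs ! i) * chi l (xs ! j') (xs ! i))"
        unfolding es et Bs Bt sw by (simp add: mult_ac)
      also have "((- 1) ^ q * (- 1) ^ q :: int) = 1" by (simp flip: power_add)
      finally show ?thesis using srt[of j' i] j' im unfolding m_def by simp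
    qed
  qed
  have Xval: "X s t u = 1 \<or> X s t u = - 1" 
    and Xsw1: "X t s u = - X s t u"
    and Xsw2: "X s u t = - X s t u" if "B s \<noteq> B t" "B s \<noteq> B u" "B t \<noteq> B u" for s t u
    using chi_values[of "B s" "B t" "B u"] chi_swap12[of "B s" "B t" "B u"] chi_swap23[of "B s" "B t" "B u"]
      BE[of s] BE[of t] BE[of u] e[of s] e[of t] e[of u] that unfolding X_def by auto
  have Xper: "X (s + m) t u = - X s t u" "X s (t + m) u = - X s t u" "X s t (u + m) = - X s t u" for s t u
    unfolding X_def Bper eper by auto
  have window: "\<exists>t. t0 \<le> t \<and> t < t0 + m \<and> P t" for t0
  proof -
    define Z where "Z i j k = X (t0 + i) (t0 + j) (t0 + k)" for i j k
    have Bne: "B (t0 + i) \<noteq> B (t0 + j)" if "i < m" "j < m" "i \<noteq> j" for i j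
      unfolding Beq using modne[of "t0 + i" "t0 + j"] modne[of "t0 + j" "t0 + i"] that
      by (cases "i < j") auto
    have vals: "i < m \<Longrightarrow> j < m \<Longrightarrow> k < m \<Longrightarrow> i \<noteq> j \<Longrightarrow> i \<noteq> k \<Longrightarrow> j \<noteq> k \<Longrightarrow> Z i j k = 1 \<or> Z i j k = - 1"
      "i < m \<Longrightarrow> j < m \<Longrightarrow> k < m \<Longrightarrow> i \<noteq> j \<Longrightarrow> i \<noteq> k \<Longrightarrow> j \<noteq> k \<Longrightarrow> Z j i k = - Z i j k"
      "i < m \<Longrightarrow> j < m \<Longrightarrow> k < m \<Longrightarrow> i \<noteq> j \<Longrightarrow> i \<noteq> k \<Longrightarrow> j \<noteq> k \<Longrightarrow> Z i k j = - Z i j k" for i j k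
      unfolding Z_def by (intro Xval Xsw1 Xsw2 Bne; simp)+
    \<comment> \<open>This is the order of the crossings along line \<open>i\<close>, counted from
      \<open>l\<close>. A failure of transitivity would make the three terms of the
      Grassmann-Pluecker relation at line \<open>i\<close>, taken with \<open>l\<close>,
      \<open>j\<close>, \<open>k\<close> and \<open>h\<close>, equal.\<close>
    have tr: "before Z i j h" if lt: "i < m" "j < m" "k < m" "h < m" and d: "distinct [i, j, k, h]"
        and jk: "before Z i j k" and kh: "before Z i k h" for i j k h
    proof (rule ccontr)
      assume n: "\<not> before Z i j h"
      define y where "y a b = e (t0 + a) * e (t0 + b) * chi l (B (t0 + a)) (B (t0 + b))" for a b
      have y: "y i a = (if a < i then - 1 else 1)" if "a < m" "a \<noteq> i" for a
      proof (cases "a < i")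
        case True
        have "y a i = 1" unfolding y_def by (rule Y) (use True lt in auto)
        moreover have "y i a = - y a i" unfolding y_def
          using chi_swap23[of l "B (t0 + a)" "B (t0 + i)"] BE[of "t0 + a"] BE[of "t0 + i"] Bne[of a i] that lt l
          by (auto simp: mult_ac)
        ultimately show ?thesis using True by simp
      next
        case False
        have "y i a = 1" unfolding y_def by (rule Y) (use False that lt in auto)
        then show ?thesis using False by simp
      qed
      have "Z i j h = - (y i j * y i h)"
        using n vals(1)[of i j h] lt d unfolding before_def y[OF lt(2)] y[OF lt(4)]
        by (auto simp: y lt split: if_splits)
      then have 1: "Z i h j = y i j * y i h" using vals(3)[of i j h] lt d by simp
      have 2: "Z i j k = y i j * y i k" "Z i k h = y i k * y i h"
        using jk kh d lt by (auto simp: y before_def split: if_splits)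
      have eq: "y i j * Z i k h = y i k * Z i h j" "y i k * Z i h j = y i h * Z i j k"
        unfolding 1 2 by (auto simp: algebra_simps)
      have sq: "e t * e t = 1" for t using e[of t] by auto
      define c where "c = e (t0 + j) * e (t0 + k) * e (t0 + h)"
      have c: "c \<noteq> 0" using e unfolding c_def by (metis mult_eq_0_iff neg_equal_0_iff_equal zero_neq_one)
      have sl: "chi l (B (t0 + i)) (B (t0 + a)) = - chi (B (t0 + i)) l (B (t0 + a))"
        if "a < m" "a \<noteq> i" for a
        using chi_swap12[of "B (t0 + i)" l "B (t0 + a)"] BE[of "t0 + a"] BE[of "t0 + i"] Bne[of a i] that lt l by auto
      have form: "y i a * Z i b b' = - (e (t0 + a) * e (t0 + b) * e (t0 + b')) *
          (chi (B (t0 + i)) l (B (t0 + a)) * chi (B (t0 + i)) (B (t0 + b)) (B (t0 + b')))"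
        if "a < m" "a \<noteq> i" for a b b'
      proof -
        have "y i a * Z i b b' = (e (t0 + i) * e (t0 + i)) * (e (t0 + a) * e (t0 + b) * e (t0 + b')) *
          (chi l (B (t0 + i)) (B (t0 + a)) * chi (B (t0 + i)) (B (t0 + b)) (B (t0 + b')))"
          unfolding y_def Z_def X_def by (simp only: mult_ac)
        then show ?thesis unfolding sq sl[OF that] by simp
      qed
      have f1: "y i j * Z i k h = - c * (chi (B (t0 + i)) l (B (t0 + j)) * chi (B (t0 + i)) (B (t0 + k)) (B (t0 + h)))"
        using form[of j k h] lt d unfolding c_def by auto
      have f2: "y i k * Z i h j = - c * (chi (B (t0 + i)) l (B (t0 + k)) * chi (B (t0 + i)) (B (t0 + h)) (B (t0 + j)))"
        using form[of k h j] lt d unfolding c_def by (auto simp: mult_ac)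
      have f3: "y i h * Z i j k = - c * (chi (B (t0 + i)) l (B (t0 + h)) * chi (B (t0 + i)) (B (t0 + j)) (B (t0 + k)))"
        using form[of h j k] lt d unfolding c_def by (auto simp: mult_ac)
      have "\<not> (chi (B (t0 + i)) l (B (t0 + j)) * chi (B (t0 + i)) (B (t0 + k)) (B (t0 + h)) =
               chi (B (t0 + i)) l (B (t0 + k)) * chi (B (t0 + i)) (B (t0 + h)) (B (t0 + j)) \<and>
               chi (B (t0 + i)) l (B (t0 + k)) * chi (B (t0 + i)) (B (t0 + h)) (B (t0 + j)) =
               chi (B (t0 + i)) l (B (t0 + h)) * chi (B (t0 + i)) (B (t0 + j)) (B (t0 + k)))"
        by (rule chi_grassmann_pluecker) (use BE l Bne lt d in auto)
      then show False using eq c unfolding f1 f2 f3 by simp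
    qed
    have "(\<exists>i. Suc i < m \<and> (\<forall>k. Suc i < k \<and> k < m \<longrightarrow> Z i (Suc i) k = - 1) \<and>
             (\<forall>k<i. Z k i (Suc i) = 1)) \<or>
         (\<forall>k. 0 < k \<and> Suc k < m \<longrightarrow> Z 0 k (m - 1) = - 1)"
      by (rule extremal_adjacent_pair[OF m]) (fact vals tr)+
    then show ?thesis
    proof
      assume "\<exists>i. Suc i < m \<and> (\<forall>k. Suc i < k \<and> k < m \<longrightarrow> Z i (Suc i) k = - 1) \<and> (\<forall>k<i. Z k i (Suc i) = 1)"
      then obtain i where i: "Suc i < m" "\<And>k. Suc i < k \<Longrightarrow> k < m \<Longrightarrow> Z i (Suc i) k = - 1"
        "\<And>k. k < i \<Longrightarrow> Z k i (Suc i) = 1" by blast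
      have "P (t0 + i)" unfolding P_def
      proof (intro allI impI)
        fix u assume u: "t0 + i + 1 < u \<and> u < t0 + i + m"
        show "X (t0 + i) (t0 + i + 1) u = - 1"
        proof (cases "u < t0 + m")
          case True
          then show ?thesis using i(2)[of "u - t0"] u unfolding Z_def by auto
        next
          case False
          \<comment> \<open>An end beyond the window is the reversed end of a line with index below
            \<open>i\<close>.\<close>
          define k where "k = u - m - t0"
          have k: "u = t0 + k + m" "k < i" using False u unfolding k_def by auto
          have "Z i k (Suc i) = - 1" using vals(2)[of k i "Suc i"] i k by simp
          then have "Z i (Suc i) k = 1" using vals(3)[of i k "Suc i"] i k by simp
          then show ?thesis unfolding k(1) Xper(3) Z_def by simp
        qed
      qed
      then show ?thesis using i(1) by (intro exI[of _ "t0 + i"]) auto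
    next
      assume Z: "\<forall>k. 0 < k \<and> Suc k < m \<longrightarrow> Z 0 k (m - 1) = - 1"
      have "P (t0 + (m - 1))" unfolding P_def
      proof (intro allI impI)
        fix u assume u: "t0 + (m - 1) + 1 < u \<and> u < t0 + (m - 1) + m"
        define k where "k = u - m - t0"
        have k: "u = t0 + k + m" "0 < k" "Suc k < m" using u m unfolding k_def by auto
        have "Z 0 (m - 1) k = 1" using vals(3)[of 0 k "m - 1"] Z k m by auto
        then have "Z (m - 1) 0 k = - 1" using vals(2)[of 0 "m - 1" k] k m by auto
        moreover have "t0 + (m - 1) + 1 = t0 + 0 + m" using m by auto
        ultimately show "X (t0 + (m - 1)) (t0 + (m - 1) + 1) u = - 1"
          unfolding Z_def k(1) by (simp only: Xper minus_minus)
      qed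
      then show ?thesis using m by (intro exI[of _ "t0 + (m - 1)"]) auto
    qed
  qed
  \<comment> \<open>Moving three ends by \<open>m\<close> reverses three lines and so flips the sign
    of \<open>X t (t + 1) (t + 2)\<close>. As \<open>m \<ge> 3\<close>, the index
    \<open>t + 2\<close> is within the range that \<open>P\<close> controls.\<close>
  have antipode: "\<not> P (t + m)" if "P t" for t
  proof
    assume "P (t + m)"
    then have "X (t + m) (t + m + 1) (t + m + 2) = - 1" using m unfolding P_def by auto
    moreover have "t + m + 1 = t + 1 + m" "t + m + 2 = t + 2 + m" by auto
    ultimately have "X t (t + 1) (t + 2) = 1" by (simp only: Xper minus_minus)
    moreover have "X t (t + 1) (t + 2) = - 1" using that m unfolding P_def by auto
    ultimately show False by simp
  qed
  define tri where "tri t = {l, B t, B (t + 1)}" for t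
  have tri_mem: "tri t \<in> empty_triangles" if "P t" for t
  proof -
    \<comment> \<open>The right-hand sides do not involve \<open>d\<close>, which is exactly
      emptiness. The line \<open>d\<close> enters through its end \<open>u\<close> in the window
      that starts at \<open>t\<close>.\<close>
    have c: "chi (B t) (B (t + 1)) d * chi (B (t + 1)) l d = e t \<and>
             chi (B (t + 1)) l d * chi l (B t) d = - (e t * e (t + 1))"
      if d: "d \<in> E - {l, B t, B (t + 1)}" for d
    proof -
      obtain i where i: "i < m" "d = xs ! i"
        using d xs(1) by (metis DiffD1 DiffD2 DiffI in_set_conv_nth insert_iff m_def singletonD)
      define t' where "t' = t mod m"
      have t': "t' < m" "t = t div m * m + t'" using m unfolding t'_def by auto
      define u where "u = (if t' \<le> i then t div m * m + i else t div m * m + i + m)"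
      have um: "u mod m = i" using i unfolding u_def by auto
      have Bu: "B u = d" unfolding B_def um i ..
      have "u \<noteq> t" "u \<noteq> t + 1" using d Bu by auto
      moreover have "t \<le> u" "u < t + m" using t' i unfolding u_def by auto
      ultimately have u: "t + 1 < u" "u < t + m" by auto
      have 1: "e t * e (t + 1) * e u * chi (B t) (B (t + 1)) d = - 1"
        using \<open>P t\<close>[unfolded P_def, rule_format, of u] u unfolding X_def Bu by simp
      have 2: "e (t + 1) * e u * chi l (B (t + 1)) d = 1" using Y[of "t + 1" u] u Bu by auto
      have 3: "e t * e u * chi l (B t) d = 1" using Y[of t u] u Bu by auto
      have 4: "chi (B (t + 1)) l d = - chi l (B (t + 1)) d"
        using chi_swap12[of l "B (t + 1)" d] l d BE[of "t + 1"] by auto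
      show ?thesis using e[of t] e[of "t + 1"] e[of u] 1 2 3 unfolding 4
        by (elim disjE) simp_all
    qed
    have "empty_triangle l (B t) (B (t + 1))"
      unfolding empty_triangle_def using c by metis
    moreover have "B t \<noteq> B (t + 1)" unfolding Beq by (rule modne) (use m in auto)
    ultimately show ?thesis
      unfolding empty_triangles_def tri_def using l BE[of t] BE[of "t + 1"] by fastforce
  qed
  have tri_inj: "s mod m = t mod m" if "tri s = tri t" for s t
  proof (rule ccontr)
    assume ne: "s mod m \<noteq> t mod m"
    have "{B s, B (s + 1)} = {B t, B (t + 1)}"
      using that BE[of s] BE[of "s + 1"] BE[of t] BE[of "t + 1"] unfolding tri_def by blast
    then have "B s = B (t + 1)" "B t = B (s + 1)" using ne Beq[of s t] by (auto simp: doubleton_eq_iff)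
    then have "s mod m = (t + 1) mod m" "t mod m = (s + 1) mod m" using Beq by auto
    then have "(s + 2) mod m = s mod m" by (metis add.assoc mod_add_left_eq one_add_one)
    then show False using modne[of s "s + 2"] m by auto
  qed
  \<comment> \<open>The second window starts right after \<open>t1\<close> and the third at
    \<open>t1 + m\<close>. Once the antipodes of the earlier choices are excluded, the three
    residues modulo \<open>m\<close> differ, and with them the sets \<open>tri\<close>.\<close>
  obtain t1 where t1: "P t1" using window[of 0] by blast
  obtain t2 where t2: "t1 + 1 \<le> t2" "t2 < t1 + 1 + m" "P t2" using window[of "t1 + 1"] by blast
  have t2': "t2 \<noteq> t1 + m" using t2 antipode[OF t1] by auto
  obtain t3 where t3: "t1 + m \<le> t3" "t3 < t1 + m + m" "P t3" using window[of "t1 + m"] by blast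
  have t3': "t3 \<noteq> t1 + m" "t3 \<noteq> t2 + m" using t3 antipode[OF t1] antipode[OF t2(3)] by auto
  have d12: "t1 mod m \<noteq> t2 mod m" using modne[of t1 t2] t2 t2' by auto
  have m3: "(t3 - m) mod m = t3 mod m" using t3 by (metis add_leE le_mod_geq)
  have d13: "t1 mod m \<noteq> t3 mod m" using modne[of t1 "t3 - m"] t3 t3' m3 by auto
  have d23: "t2 mod m \<noteq> t3 mod m"
  proof -
    have "t3 - m \<noteq> t2" "t3 - m < t2 + m" "t2 < (t3 - m) + m" using t1 t2 t2' t3 t3' by linarith+
    then show ?thesis using modne[of t2 "t3 - m"] modne[of "t3 - m" t2] m3 by (metis linorder_neqE_nat)
  qed
  have "tri t1 \<noteq> tri t2" "tri t1 \<noteq> tri t3" "tri t2 \<noteq> tri t3"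
    using tri_inj d12 d13 d23 by blast+
  then have "card {tri t1, tri t2, tri t3} = 3" by auto
  moreover have "{tri t1, tri t2, tri t3} \<subseteq> {S \<in> empty_triangles. l \<in> S}"
    using tri_mem t1 t2 t3 unfolding tri_def by auto
  moreover have "finite {S \<in> empty_triangles. l \<in> S}"
    by (rule finite_subset[of _ "Pow E"]) (use finite_ground in \<open>auto simp: empty_triangles_def\<close>)
  ultimately show ?thesis using card_mono by metis
qed

text \<open>Double counting: every line belongs to at least three triangles, and every triangle to
  exactly three lines.\<close>

lemma card_empty_triangles:
  assumes "card E \<ge> 4"
  shows "card empty_triangles \<ge> card E"
proof -
  have fin: "finite empty_triangles"
    by (rule finite_subset[of _ "Pow E"]) (use finite_ground in \<open>auto simp: empty_triangles_def\<close>)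
  have "3 * card E = (\<Sum>l\<in>E. 3)" by simp
  also have "\<dots> \<le> (\<Sum>l\<in>E. card {S \<in> empty_triangles. l \<in> S})"
    by (intro sum_mono three_empty_triangles_at_line assms)
  also have "\<dots> = (\<Sum>S\<in>empty_triangles. card {l \<in> E. l \<in> S})"
    using sum_multicount_gen[OF finite_ground fin, of "\<lambda>l S. l \<in> S" "\<lambda>S. card {l \<in> E. l \<in> S}"] by simp
  also have "\<dots> = (\<Sum>S\<in>empty_triangles. 3)"
  proof (rule sum.cong[OF refl])
    fix S assume "S \<in> empty_triangles"
    then obtain a b c where S: "S = {a, b, c}" "a \<in> E" "b \<in> E" "c \<in> E" "distinct [a, b, c]"
      unfolding empty_triangles_def by blast
    then have "{l \<in> E. l \<in> S} = {a, b, c}" by auto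
    then show "card {l \<in> E. l \<in> S} = 3" using S(5) by simp
  qed
  finally show ?thesis by simp
qed

end

lemma (in chirotope) empty_triangle_rotate:
  assumes "empty_triangle a b c" "a \<in> E" "b \<in> E" "c \<in> E" "distinct [a, b, c]"
  shows "empty_triangle b c a"
  unfolding empty_triangle_def
proof (intro ballI)
  fix d e assume de: "d \<in> E - {b, c, a}" "e \<in> E - {b, c, a}"
  have 1: "chi b c d * chi c a d = chi b c e * chi c a e" "chi c a d * chi a b d = chi c a e * chi a b e"
    using assms(1) de unfolding empty_triangle_def by blast+
  have 2: "chi c a d * chi c a d = 1" "chi c a e * chi c a e = 1"
    using chi_values[of c a d] chi_values[of c a e] assms de by auto
  have "chi a b x * chi b c x = (chi b c x * chi c a x) * (chi c a x * chi a b x)" if "chi c a x * chi c a x = 1" for x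
  proof -
    have "(chi b c x * chi c a x) * (chi c a x * chi a b x) = (chi c a x * chi c a x) * (chi a b x * chi b c x)"
      by (simp only: mult_ac)
    then show ?thesis using that by simp
  qed
  from this[OF 2(1)] this[OF 2(2)]
  have "chi a b d * chi b c d = chi a b e * chi b c e" by (simp only: 1)
  then show "chi c a d * chi a b d = chi c a e * chi a b e \<and> chi a b d * chi b c d = chi a b e * chi b c e"
    using 1(2) by blast
qed

section \<open>Separation on the sphere\<close>

lemma compact_S2: "compact S2" and closed_S2: "closed S2"
  unfolding S2_def by simp_all

lemma sphere_chart:
  assumes "p \<in> S2"
  obtains f h where "homeomorphism (S2 - {p}) (UNIV :: complex set) f h"
proof -
  have "(sphere 0 1 \<inter> UNIV) - {p} homeomorphic (UNIV :: complex set)"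
    by (rule homeomorphic_punctured_affine_sphere_affine) (use assms in \<open>auto simp: S2_def\<close>)
  then show ?thesis using that unfolding S2_def homeomorphic_def by auto
qed

lemma components_two_open:
  fixes U W :: "'a::topological_space set"
  assumes S: "S = U \<union> W" "U \<inter> W = {}" and con: "connected U" "connected W" and ne: "U \<noteq> {}" "W \<noteq> {}"
    and op: "openin (top_of_set S) U" "openin (top_of_set S) W"
  shows "components S = {U, W}"
proof -
  have max: "D = A" if "S = A \<union> B" "A \<inter> B = {}" "A \<noteq> {}" "openin (top_of_set S) A" "openin (top_of_set S) B"
      "A \<subseteq> D" "D \<subseteq> S" "connected D" for A B D
  proof -
    have rel: "openin (top_of_set D) (D \<inter> V)" if V: "openin (top_of_set S) V" for V
    proof -
      obtain T where "open T" "V = S \<inter> T" using V unfolding openin_open by blast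
      then have "D \<inter> V = D \<inter> T" using \<open>D \<subseteq> S\<close> by blast
      then show ?thesis using \<open>open T\<close> by (simp add: openin_open_Int)
    qed
    have "openin (top_of_set D) (D \<inter> A)" "openin (top_of_set D) (D \<inter> B)"
      using rel that by blast+
    moreover have "D \<subseteq> D \<inter> A \<union> D \<inter> B" "(D \<inter> A) \<inter> (D \<inter> B) = {}" using that by blast+
    ultimately have "D \<inter> A = {} \<or> D \<inter> B = {}"
      using \<open>connected D\<close> unfolding connected_openin by blast
    then show ?thesis using that by blast
  qed
  have "U \<in> components S"
    unfolding in_components_maximal
    using max[OF S ne(1) op] S con ne by blast
  moreover have "W \<in> components S"
    unfolding in_components_maximal
    using max[of W U, OF _ _ ne(2) op(2,1)] S con ne by blast
  moreover have "K = U \<or> K = W" if "K \<in> components S" for K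
  proof -
    have "K \<noteq> {}" "K \<subseteq> S" using in_components_nonempty[OF that] in_components_subset[OF that] by blast+
    then have "K \<inter> U \<noteq> {} \<or> K \<inter> W \<noteq> {}" using S by blast
    then show ?thesis using components_nonoverlap[OF that \<open>U \<in> components S\<close>]
        components_nonoverlap[OF that \<open>W \<in> components S\<close>] by blast
  qed
  ultimately show ?thesis by blast
qed

text \<open>The chart centred at \<open>p\<close> moves \<open>J\<close> into the plane, where the
  Jordan curve theorem applies. Adding \<open>p\<close> to the image of the outside keeps it
  connected, because the outside is unbounded and therefore accumulates at \<open>p\<close>.\<close>

lemma jordan_curve_sphere:
  assumes g: "simple_path g" "pathfinish g = pathstart g" and J: "path_image g = J" "J \<subseteq> S2"
    and p: "p \<in> S2 - J"
  obtains U W where "U \<noteq> W" "components (S2 - J) = {U, W}"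
    "closure U = U \<union> J" "closure W = W \<union> J"
proof -
  obtain f h where hom: "homeomorphism (S2 - {p}) (UNIV :: complex set) f h"
    using sphere_chart p by blast
  have hf: "\<And>x. x \<in> S2 - {p} \<Longrightarrow> h (f x) = x" and fh: "\<And>y. f (h y) = y"
    and cf: "continuous_on (S2 - {p}) f" and ch: "continuous_on UNIV h"
    and ih: "range h = S2 - {p}"
    using hom unfolding homeomorphism_def by auto
  define c where "c = f \<circ> g"
  have gJ: "path_image g \<subseteq> S2 - {p}" using J p by auto
  have injf: "inj_on f (S2 - {p})" by (metis hf inj_on_inverseI)
  have "simple_path c"
    unfolding c_def using simple_path_continuous_image[OF g(1)] continuous_on_subset[OF cf gJ] inj_on_subset[OF injf gJ] by blast
  moreover have "pathfinish c = pathstart c" using g(2) unfolding c_def pathfinish_def pathstart_def by simp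
  ultimately have JC': "inside(path_image c) \<noteq> {} \<and>
          open(inside(path_image c)) \<and>
          connected(inside(path_image c)) \<and>
          outside(path_image c) \<noteq> {} \<and>
          open(outside(path_image c)) \<and>
          connected(outside(path_image c)) \<and>
          bounded(inside(path_image c)) \<and>
          \<not> bounded(outside(path_image c)) \<and>
          inside(path_image c) \<inter> outside(path_image c) = {} \<and>
          inside(path_image c) \<union> outside(path_image c) =
          - path_image c \<and>
          frontier(inside(path_image c)) = path_image c \<and>
          frontier(outside(path_image c)) = path_image c"
    by (rule Jordan_inside_outside)
  define I Q where "I = inside (path_image c)" and "Q = outside (path_image c)"
  have JC: "I \<noteq> {}" "open I" "connected I" "Q \<noteq> {}" "connected Q" "bounded I" "\<not> bounded Q"
    "I \<inter> Q = {}" "I \<union> Q = - path_image c" "frontier I = path_image c" "frontier Q = path_image c"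
    using JC' unfolding I_def Q_def by simp_all
  have pc: "path_image c = f ` J" unfolding c_def path_image_compose J ..
  have hJ: "h ` path_image c = J" unfolding pc using hf J p by force
  define U W where "U = h ` I" and "W = insert p (h ` Q)"
  have inj: "inj h" by (metis fh injI)
  have parts: "U \<union> h ` Q \<union> J = S2 - {p}"
  proof -
    have "I \<union> Q \<union> path_image c = UNIV" using JC(9) by blast
    then have "h ` (I \<union> Q \<union> path_image c) = S2 - {p}" using ih by simp
    then show ?thesis unfolding image_Un hJ U_def .
  qed
  have disj: "U \<inter> h ` Q = {}" "U \<inter> J = {}" "h ` Q \<inter> J = {}"
    unfolding U_def hJ[symmetric] image_Int[OF inj, symmetric]
    using JC(8,9) by blast+
  have pU: "p \<notin> U" "p \<notin> h ` Q" using ih unfolding U_def by blast+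
  have eq: "S2 - J = U \<union> W" and UW: "U \<inter> W = {}"
    using parts disj pU p unfolding W_def by blast+
  have Usub: "U \<subseteq> S2" "W \<subseteq> S2" using eq by auto
  have hcl: "h ` closure A \<subseteq> closure (h ` A)" for A
  proof -
    have "continuous_on (closure A) h" using ch continuous_on_subset by blast
    then show ?thesis by (rule image_closure_subset) (simp_all add: closure_subset)
  qed
  have JU: "J \<subseteq> closure U" and JQ: "J \<subseteq> closure (h ` Q)"
  proof -
    have "path_image c \<subseteq> closure I" "path_image c \<subseteq> closure Q"
      using JC(10,11) unfolding frontier_def by blast+
    then show "J \<subseteq> closure U" "J \<subseteq> closure (h ` Q)"
      using hcl[of I] hcl[of Q] unfolding hJ[symmetric] U_def by blast+
  qed
  have cptU: "compact (U \<union> J)"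
  proof -
    have "closed (I \<union> path_image c)"
      using closure_Un_frontier[of I] JC(10) by (metis closed_closure)
    moreover have "bounded (I \<union> path_image c)"
      using JC(6) by (metis \<open>simple_path c\<close> bounded_Un bounded_simple_path_image)
    ultimately have "compact (I \<union> path_image c)" by (simp add: compact_eq_bounded_closed)
    then have "compact (h ` (I \<union> path_image c))"
      using ch compact_continuous_image continuous_on_subset by blast
    then show ?thesis unfolding image_Un hJ U_def .
  qed
  have openW: "openin (top_of_set S2) W"
  proof -
    have "W = S2 - (U \<union> J)" using eq UW J(2) disj(2) by blast
    moreover have "closedin (top_of_set S2) (U \<union> J)"
      using cptU Usub J by (simp add: compact_imp_closed closed_subset)
    ultimately show ?thesis by (simp add: openin_diff)
  qed
  have openU: "openin (top_of_set S2) U"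
  proof -
    have "openin (top_of_set (S2 - {p})) U"
      using homeomorphism_imp_open_map[OF homeomorphism_symD[OF hom], of I] JC(2) unfolding U_def by auto
    moreover have "openin (top_of_set S2) (S2 - {p})"
      by (simp add: openin_delete)
    ultimately show ?thesis using openin_trans by blast
  qed
  have closedW: "closed (W \<union> J)"
  proof -
    have "W \<union> J = S2 - U" using eq UW J(2) disj(2) by blast
    moreover have "closedin (top_of_set S2) (S2 - U)" using openU by (simp add: closedin_diff)
    ultimately show ?thesis using closed_S2 closedin_closed_trans by metis
  qed
  have pcl: "p \<in> closure (h ` Q)"
  proof (rule ccontr)
    assume "p \<notin> closure (h ` Q)"
    then obtain e where e: "e > 0" "\<And>y. y \<in> h ` Q \<Longrightarrow> \<not> dist y p < e"
      unfolding closure_approachable by blast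
    have sub: "S2 - ball p e \<subseteq> S2 - {p}" using e by auto
    have "compact (S2 - ball p e)" by (simp add: compact_diff compact_S2)
    then have "compact (f ` (S2 - ball p e))"
      using compact_continuous_image continuous_on_subset[OF cf sub] by blast
    then have "bounded (f ` (S2 - ball p e))" by (rule compact_imp_bounded)
    moreover have "h ` Q \<subseteq> S2 - ball p e"
    proof (intro image_subsetI)
      fix y assume "y \<in> Q"
      then have "\<not> dist (h y) p < e" using e(2) by blast
      moreover have "h y \<in> S2" using ih by blast
      ultimately show "h y \<in> S2 - ball p e" by (simp add: dist_commute)
    qed
    then have "f ` h ` Q \<subseteq> f ` (S2 - ball p e)" by (rule image_mono)
    moreover have "f ` h ` Q = Q" unfolding image_image fh by simp
    ultimately have "bounded Q" using bounded_subset by metis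
    then show False using JC(7) by blast
  qed
  have conU: "connected U" unfolding U_def
    using JC(3) connected_continuous_image continuous_on_subset[OF ch] by blast
  have conQ: "connected (h ` Q)"
    using JC(5) connected_continuous_image continuous_on_subset[OF ch] by blast
  have conW: "connected W"
    using connected_intermediate_closure[OF conQ, of W] pcl closure_subset[of "h ` Q"]
    unfolding W_def by blast
  have comps: "components (S2 - J) = {U, W}"
  proof (rule components_two_open[OF eq UW conU conW])
    show "U \<noteq> {}" using JC(1) unfolding U_def by blast
    show "W \<noteq> {}" unfolding W_def by blast
    show "openin (top_of_set (S2 - J)) U" "openin (top_of_set (S2 - J)) W"
      using openU openW eq by (metis Diff_subset openin_subset_trans sup_ge1 sup_ge2)+
  qed
  have clU: "closure U = U \<union> J"
    using JU cptU closure_subset[of U] by (meson closure_minimal compact_imp_closed subset_antisym sup_ge1 Un_least)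
  have clW: "closure W = W \<union> J"
  proof -
    have "J \<subseteq> closure W" using JQ closure_mono[of "h ` Q" W] unfolding W_def by blast
    then show ?thesis using closedW closure_subset[of W] by (meson closure_minimal subset_antisym sup_ge1 Un_least)
  qed
  have "U \<noteq> W" using pU unfolding W_def by blast
  then show ?thesis using that comps clU clW by blast
qed

text \<open>In the chart centred at the missing point \<open>q\<close>, the set \<open>V\<close> is
  a connected open subset of the plane, which no single point disconnects.\<close>

lemma connected_delete_sphere:
  assumes V: "openin (top_of_set S2) V" "connected V" and q: "q \<in> S2 - V"
  shows "connected (V - {p})"
proof (cases "p \<in> V")
  case True
  obtain f h where hom: "homeomorphism (S2 - {q}) (UNIV :: complex set) f h"
    using sphere_chart q by blast
  have hf: "\<And>x. x \<in> S2 - {q} \<Longrightarrow> h (f x) = x"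
    and cf: "continuous_on (S2 - {q}) f" and ch: "continuous_on UNIV h"
    using hom unfolding homeomorphism_def by auto
  have sub: "V \<subseteq> S2 - {q}" using V q openin_imp_subset by fastforce
  have "openin (top_of_set (S2 - {q})) V"
    using V(1) sub by (metis Diff_subset openin_subset_trans)
  then have "open (f ` V)" using homeomorphism_imp_open_map[OF hom, of V] by simp
  moreover have "connected (f ` V)" using connected_continuous_image continuous_on_subset[OF cf sub] V(2) by blast
  ultimately have "connected (f ` V - {f p})" by (rule connected_open_delete) simp
  then have "connected (h ` (f ` V - {f p}))"
    using connected_continuous_image continuous_on_subset[OF ch] by blast
  moreover have "h ` (f ` V - {f p}) = V - {p}"
  proof
    show "h ` (f ` V - {f p}) \<subseteq> V - {p}"
    proof (intro subsetI)
      fix z assume "z \<in> h ` (f ` V - {f p})"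
      then obtain x where x: "x \<in> V" "f x \<noteq> f p" "z = h (f x)" by auto
      have "x \<in> S2 - {q}" using sub x(1) by blast
      then have "h (f x) = x" by (rule hf)
      then show "z \<in> V - {p}" using x by (metis DiffI singletonD)
    qed
    show "V - {p} \<subseteq> h ` (f ` V - {f p})"
    proof
      fix x assume x: "x \<in> V - {p}"
      then have "x \<in> S2 - {q}" "p \<in> S2 - {q}" using sub True by blast+
      then have "h (f x) = x" "h (f p) = p" using hf by blast+
      then have "f x \<noteq> f p" using x by auto
      then show "x \<in> h ` (f ` V - {f p})" using x \<open>h (f x) = x\<close> by (intro image_eqI[of _ _ "f x"]) auto
    qed
  qed
  ultimately show ?thesis by simp
qed (use V in simp)

text \<open>The planar theorem is transferred through the chart centred at \<open>p\<close>. Since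
  \<open>p\<close> lies in \<open>T\<close> but not in \<open>S\<close>, the image of
  \<open>S\<close> is compact and the complements of \<open>T\<close> and
  \<open>S \<union> T\<close> lose nothing. Only a connection in \<open>S2 - S\<close> could run
  through \<open>p\<close>, and \<open>connected_delete_sphere\<close> lets it avoid that
  point.\<close>

lemma Janiszewski_sphere:
  assumes S: "closed S" "S \<subseteq> S2" "S \<noteq> {}" and T: "closed T" "T \<subseteq> S2" and p: "p \<in> T - S"
    and con: "connected (S \<inter> T)"
    and cS: "connected_component (S2 - S) a b" and cT: "connected_component (S2 - T) a b"
  shows "connected_component (S2 - (S \<union> T)) a b"
proof -
  obtain f h where hom: "homeomorphism (S2 - {p}) (UNIV :: complex set) f h"
    using sphere_chart p T by blast
  have hf: "\<And>x. x \<in> S2 - {p} \<Longrightarrow> h (f x) = x" and fh: "\<And>y. f (h y) = y"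
    and cf: "continuous_on (S2 - {p}) f" and ch: "continuous_on UNIV h"
    and ih: "range h = S2 - {p}"
    using hom unfolding homeomorphism_def by auto
  have ab: "a \<in> S2 - {p}" "b \<in> S2 - {p}" using connected_component_in[OF cT] p by auto
  have transfer: "connected_component (- f ` (X - {p})) (f a) (f b)"
    if K: "connected K" "K \<subseteq> S2 - X - {p}" "a \<in> K" "b \<in> K" and X: "X \<subseteq> S2" for K X
  proof -
    have "connected (f ` K)"
      using K connected_continuous_image continuous_on_subset[OF cf, of K] by blast
    moreover have "f ` K \<subseteq> - f ` (X - {p})"
    proof (intro subsetI ComplI)
      fix z assume "z \<in> f ` K" "z \<in> f ` (X - {p})"
      then obtain x y where "x \<in> K" "f x = f y" "y \<in> X" "y \<noteq> p" by auto
      moreover have "x \<in> S2 - X - {p}" "y \<in> S2 - {p}" using calculation K(2) X by blast+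
      then have "h (f x) = x" "h (f y) = y" using hf by blast+
      ultimately have "x = y" by metis
      then show False using \<open>x \<in> S2 - X - {p}\<close> \<open>y \<in> X\<close> by blast
    qed
    ultimately show ?thesis unfolding connected_component_def
      using K(3,4) by (intro exI[of _ "f ` K"]) simp
  qed
  have "connected_component (- f ` S) (f a) (f b)"
  proof -
    define K where "K = connected_component_set (S2 - S) a"
    have opS: "openin (top_of_set S2) (S2 - S)" using S by (simp add: openin_diff closed_subset)
    have "openin (top_of_set (S2 - S)) K"
      unfolding K_def
    proof (rule openin_connected_component_locally_connected)
      show "locally connected (S2 - S)"
        using locally_open_subset[OF _ opS] locally_connected_sphere unfolding S2_def by blast
    qed
    then have "openin (top_of_set S2) K" using opS openin_trans by blast
    moreover have "connected K" unfolding K_def by simp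
    moreover obtain q where "q \<in> S" using S by blast
    moreover have "K \<subseteq> S2 - S" unfolding K_def by (rule connected_component_subset)
    ultimately have "connected (K - {p})" using connected_delete_sphere[of K q p] S by blast
    moreover have "a \<in> K" "b \<in> K" using cS connected_component_in[OF cS]
      unfolding K_def by (auto simp: connected_component_refl_eq)
    moreover have "K - {p} \<subseteq> S2 - S - {p}" using \<open>K \<subseteq> S2 - S\<close> by blast
    ultimately have "connected_component (- f ` (S - {p})) (f a) (f b)"
      using ab S(2) by (intro transfer[of "K - {p}"]) simp_all
    then show ?thesis using p by simp
  qed
  moreover have "connected_component (- f ` (T - {p})) (f a) (f b)"
  proof -
    obtain K where "connected K" "K \<subseteq> S2 - T" "a \<in> K" "b \<in> K"
      using cT unfolding connected_component_def by blast
    then show ?thesis using p T by (intro transfer[of K]) auto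
  qed
  moreover have "compact (f ` S)"
  proof -
    have "compact S" using S compact_S2 by (metis closed_Int_compact inf.orderE)
    then show ?thesis using compact_continuous_image continuous_on_subset[OF cf] S p by blast
  qed
  moreover have "closed (f ` (T - {p}))"
  proof -
    have "closedin (top_of_set (S2 - {p})) (T - {p})"
    proof -
      have "T - {p} = (S2 - {p}) \<inter> T" using T by blast
      then show ?thesis using T(1) by (metis closedin_closed_Int)
    qed
    then show ?thesis using homeomorphism_imp_closed_map[OF hom] by simp
  qed
  moreover have "connected (f ` S \<inter> f ` (T - {p}))"
  proof -
    have "f ` S \<inter> f ` (T - {p}) = f ` (S \<inter> T)"
    proof (rule subset_antisym)
      show "f ` S \<inter> f ` (T - {p}) \<subseteq> f ` (S \<inter> T)"
      proof (intro subsetI)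
        fix z assume "z \<in> f ` S \<inter> f ` (T - {p})"
        then obtain x y where "x \<in> S" "f x = f y" "y \<in> T" "y \<noteq> p" "z = f y" by auto
        moreover have "x \<in> S2 - {p}" "y \<in> S2 - {p}" using calculation S(2) T(2) p by blast+
        then have "h (f x) = x" "h (f y) = y" using hf by blast+
        ultimately have "x = y" by metis
        then show "z \<in> f ` (S \<inter> T)" using \<open>x \<in> S\<close> \<open>y \<in> T\<close> \<open>z = f y\<close> by blast
      qed
    qed (use p in auto)
    moreover have "S \<inter> T \<subseteq> S2 - {p}" using S p by auto
    ultimately show ?thesis using con connected_continuous_image continuous_on_subset[OF cf] by metis
  qed
  ultimately have "connected_component (- (f ` S \<union> f ` (T - {p}))) (f a) (f b)"
    using Janiszewski by blast
  then obtain K where K: "connected K" "K \<subseteq> - (f ` S \<union> f ` (T - {p}))" "f a \<in> K" "f b \<in> K"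
    unfolding connected_component_def by blast
  have "connected (h ` K)" using K(1) ch connected_continuous_image continuous_on_subset by blast
  moreover have "h ` K \<subseteq> S2 - (S \<union> T)"
  proof (intro image_subsetI)
    fix x assume x: "x \<in> K"
    have "h x \<in> S2 - {p}" using ih by blast
    moreover have "h x \<notin> S \<union> T"
    proof
      assume "h x \<in> S \<union> T"
      then have "h x \<in> S \<union> (T - {p})" using calculation by blast
      then have "f (h x) \<in> f ` S \<union> f ` (T - {p})" by blast
      then show False using fh[of x] K(2) x by auto
    qed
    ultimately show "h x \<in> S2 - (S \<union> T)" by blast
  qed
  moreover have "a \<in> h ` K" "b \<in> h ` K" using K hf ab by (metis image_eqI)+
  ultimately show ?thesis unfolding connected_component_def by blast
qed

section \<open>Edges and triangular cells\<close>

lemma connected_subset_arc_eq: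
  fixes u :: "real \<Rightarrow> 'a::euclidean_space"
  assumes "arc u" and K: "connected K" "K \<subseteq> path_image u" "pathstart u \<in> K" "pathfinish u \<in> K"
  shows "K = path_image u"
proof -
  obtain h where h: "homeomorphism {0..1} (path_image u) u h"
    using homeomorphism_arc[OF \<open>arc u\<close>] by blast
  have hu: "\<And>x. x \<in> {0..1} \<Longrightarrow> h (u x) = x" and uh: "\<And>y. y \<in> path_image u \<Longrightarrow> u (h y) = y"
    and ch: "continuous_on (path_image u) h"
    using h unfolding homeomorphism_def by auto
  have "connected (h ` K)"
    using connected_continuous_image[OF continuous_on_subset[OF ch K(2)] K(1)] .
  moreover have "0 \<in> h ` K" "1 \<in> h ` K"
    using K hu[of 0] hu[of 1] unfolding pathstart_def pathfinish_def by (force intro: image_eqI)+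
  ultimately have "{0..1} \<subseteq> h ` K" by (rule connected_contains_Icc)
  then have "u ` {0..1} \<subseteq> u ` h ` K" by (rule image_mono)
  also have "u ` h ` K = K" using uh K(2) by (force simp: image_image)
  finally show ?thesis using K(2) unfolding path_image_def by blast
qed

text \<open>The end points of \<open>g\<close> split \<open>c\<close> into two arcs. Without its
  ends \<open>g\<close> is still connected, so it lies in one of these arcs and fills it; what
  remains is the other one without its ends.\<close>

lemma connected_pseudocircle_minus_arc:
  assumes "pseudocircle c" "arc g" "path_image g \<subseteq> c"
  shows "connected (c - path_image g)"
proof -
  obtain k where k: "simple_path k" "pathfinish k = pathstart k" "path_image k = c"
    using assms(1) unfolding pseudocircle_def by blast
  define x y where "x = pathstart g" and "y = pathfinish g"
  have xy: "x \<in> c" "y \<in> c" "x \<noteq> y"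
    using assms(3) arc_distinct_ends[OF assms(2)] pathstart_in_path_image[of g] pathfinish_in_path_image[of g]
    unfolding x_def y_def by auto
  obtain u d where ud: "arc u" "arc d" "pathstart u = x" "pathfinish u = y"
    "pathstart d = y" "pathfinish d = x" "path_image u \<inter> path_image d = {x, y}"
    "path_image u \<union> path_image d = c"
    using exists_double_arc[OF k(1,2), of x y] xy k(3) by metis
  have con: "connected (path_image g - {x, y})"
    using connected_simple_path_endless[OF arc_imp_simple_path[OF assms(2)]] unfolding x_def y_def .
  have ends: "x \<in> path_image g" "y \<in> path_image g" unfolding x_def y_def by auto
  have cl: "closed (path_image u)" "closed (path_image d)"
    using ud by (simp_all add: closed_arc_image)
  have "path_image u \<inter> (path_image g - {x, y}) = {} \<or> path_image d \<inter> (path_image g - {x, y}) = {}"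
    using connected_closedD[OF con _ _ cl] ud(7,8) assms(3) by blast
  then show ?thesis
  proof
    assume "path_image u \<inter> (path_image g - {x, y}) = {}"
    then have sub: "path_image g \<subseteq> path_image d" using ud(7,8) assms(3) by blast
    have "path_image g = path_image d"
      by (rule connected_subset_arc_eq) (use ud sub ends assms(2) in \<open>auto simp: connected_arc_image\<close>)
    moreover have "c - path_image d = path_image u - {x, y}" using ud(7,8) by blast
    ultimately have "c - path_image g = path_image u - {pathstart u, pathfinish u}" using ud(3,4) by simp
    then show ?thesis using connected_simple_path_endless ud(1) arc_imp_simple_path by metis
  next
    assume "path_image d \<inter> (path_image g - {x, y}) = {}"
    then have sub: "path_image g \<subseteq> path_image u" using ud(7,8) assms(3) by blast
    have "path_image g = path_image u"
      by (rule connected_subset_arc_eq) (use ud sub ends assms(2) in \<open>auto simp: connected_arc_image\<close>)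
    moreover have "c - path_image u = path_image d - {y, x}" using ud(7,8) by blast
    ultimately have "c - path_image g = path_image d - {pathstart d, pathfinish d}" using ud(5,6) by simp
    then show ?thesis using connected_simple_path_endless ud(2) arc_imp_simple_path by metis
  qed
qed

lemma two_sides:
  assumes "pseudocircle d" "p \<in> S2 - d"
  obtains U W where "U \<noteq> W" "components (S2 - d) = {U, W}"
    "closure U = U \<union> d" "closure W = W \<union> d"
  using assms jordan_curve_sphere unfolding pseudocircle_def by metis

lemma pseudocircle_subset: "pseudocircle d \<Longrightarrow> d \<subseteq> S2"
  unfolding pseudocircle_def by blast

lemma closed_pseudocircle: "pseudocircle d \<Longrightarrow> closed d"
  unfolding pseudocircle_def using closed_path_image simple_path_imp_path by blast

lemma connected_pseudocircle: "pseudocircle d \<Longrightarrow> connected d"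
  unfolding pseudocircle_def using connected_simple_path_image by blast

definition free_edge :: "(real^3) set set \<Rightarrow> (real^3) set \<Rightarrow> real^3 \<Rightarrow> real^3 \<Rightarrow> bool" where
  "free_edge A c x y \<longleftrightarrow> (\<exists>g. arc g \<and> pathstart g = x \<and> pathfinish g = y \<and> path_image g \<subseteq> c \<and>
      path_image g \<inter> \<Union>(A - {c}) \<subseteq> {x, y})"

lemma free_edge_sym: "free_edge A c x y \<Longrightarrow> free_edge A c y x"
  unfolding free_edge_def
proof (elim exE conjE)
  fix g assume "arc g" "pathstart g = x" "pathfinish g = y" "path_image g \<subseteq> c"
    "path_image g \<inter> \<Union>(A - {c}) \<subseteq> {x, y}"
  then show "\<exists>g. arc g \<and> pathstart g = y \<and> pathfinish g = x \<and> path_image g \<subseteq> c \<and>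
      path_image g \<inter> \<Union>(A - {c}) \<subseteq> {y, x}"
    by (intro exI[of _ "reversepath g"]) (simp add: arc_reversepath insert_commute)
qed

lemma free_edge_subpath:
  assumes h: "arc h" "path_image h \<subseteq> c" and st: "s \<in> {0..1}" "t \<in> {0..1}" "s \<noteq> t"
    and free: "\<And>w d. \<lbrakk>min s t < w; w < max s t; d \<in> A; d \<noteq> c\<rbrakk> \<Longrightarrow> h w \<notin> d"
  shows "free_edge A c (h s) (h t)"
  unfolding free_edge_def
proof (intro exI[of _ "subpath s t h"] conjI)
  show "arc (subpath s t h)" using h st by (intro arc_subpath_arc) auto
  show "path_image (subpath s t h) \<subseteq> c" using path_image_subpath_subset[OF st(1,2), of h] h(2) by blast
  show "path_image (subpath s t h) \<inter> \<Union> (A - {c}) \<subseteq> {h s, h t}"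
  proof
    fix z assume z: "z \<in> path_image (subpath s t h) \<inter> \<Union> (A - {c})"
    have "path_image (subpath s t h) = h ` {min s t..max s t}"
      by (simp add: path_image_subpath min_def max_def)
    then have "z \<in> h ` {min s t..max s t}" using z by simp
    then obtain w where w: "z = h w" "min s t \<le> w" "w \<le> max s t" by auto
    moreover obtain d where "d \<in> A" "d \<noteq> c" "z \<in> d" using z by blast
    ultimately have "\<not> (min s t < w \<and> w < max s t)" using free[of w d] by blast
    then have "w = s \<or> w = t" using w(2,3) by linarith
    then show "z \<in> {h s, h t}" using w by auto
  qed
qed simp_all

lemma simple_arrangementD:
  assumes "simple_arrangement A"
  shows "finite A" "\<And>c. c \<in> A \<Longrightarrow> pseudocircle c"
    "\<And>a b c. \<lbrakk>a \<in> A; b \<in> A; c \<in> A; distinct [a, b, c]; x \<in> a; x \<in> b\<rbrakk> \<Longrightarrow> x \<notin> c"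
proof -
  show "finite A" "\<And>c. c \<in> A \<Longrightarrow> pseudocircle c"
    using assms unfolding simple_arrangement_def arrangement_def by blast+
  fix a b c assume "a \<in> A" "b \<in> A" "c \<in> A" "distinct [a, b, c]" "x \<in> a" "x \<in> b"
  moreover from this have "a \<inter> b \<inter> c = {}"
    using assms unfolding simple_arrangement_def by (metis distinct_length_2_or_more)
  ultimately show "x \<notin> c" by blast
qed

lemma crossing_pair:
  assumes "simple_arrangement A" "pairwise_intersecting A" "c \<in> A" "d \<in> A" "c \<noteq> d"
  shows "card (c \<inter> d) = 2" "\<And>p. p \<in> c \<Longrightarrow> p \<in> d \<Longrightarrow> crosses_at c d p"
proof -
  have "c \<inter> d = {} \<or> (card (c \<inter> d) = 2 \<and> (\<forall>p\<in>c \<inter> d. crosses_at c d p \<and> crosses_at d c p))"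
    using assms(1,3-5) unfolding simple_arrangement_def arrangement_def by blast
  moreover have "c \<inter> d \<noteq> {}" using assms(2-5) unfolding pairwise_intersecting_def by blast
  ultimately show "card (c \<inter> d) = 2" "\<And>p. p \<in> c \<Longrightarrow> p \<in> d \<Longrightarrow> crosses_at c d p" by blast+
qed

lemma triangle_from_free_edges:
  assumes A: "simple_arrangement A" "pairwise_intersecting A"
    and abc: "a \<in> A" "b \<in> A" "c \<in> A" "distinct [a, b, c]"
    and p: "p \<in> b" "p \<in> c" and q: "q \<in> a" "q \<in> c" and r: "r \<in> a" "r \<in> b"
    and edges: "free_edge A a q r" "free_edge A b r p" "free_edge A c p q"
  shows "\<exists>F\<in>triangles A. closure F \<inter> crossings A = {p, q, r}"
proof -
  note sa = simple_arrangementD[OF A(1)]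
  obtain f where f: "arc f" "pathstart f = q" "pathfinish f = r" "path_image f \<subseteq> a"
      "path_image f \<inter> \<Union>(A - {a}) \<subseteq> {q, r}"
    using edges(1) unfolding free_edge_def by blast
  obtain g where g: "arc g" "pathstart g = r" "pathfinish g = p" "path_image g \<subseteq> b"
      "path_image g \<inter> \<Union>(A - {b}) \<subseteq> {r, p}"
    using edges(2) unfolding free_edge_def by blast
  obtain h where h: "arc h" "pathstart h = p" "pathfinish h = q" "path_image h \<subseteq> c"
      "path_image h \<inter> \<Union>(A - {c}) \<subseteq> {p, q}"
    using edges(3) unfolding free_edge_def by blast
  have pn: "p \<notin> a" using sa(3)[of b c a p] abc p by auto
  have qn: "q \<notin> b" using sa(3)[of a c b q] abc q by auto
  have rn: "r \<notin> c" using sa(3)[of a b c r] abc r by auto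
  have nA: "b \<in> A - {a}" "c \<in> A - {a}" "a \<in> A - {b}" "c \<in> A - {b}" "a \<in> A - {c}" "b \<in> A - {c}"
    using abc by (simp_all; metis)+
  have fg: "path_image f \<inter> path_image g = {r}"
  proof -
    have "path_image f \<inter> path_image g \<subseteq> {q, r} \<inter> {r, p}" using f(4,5) g(4,5) nA by blast
    moreover have "r \<in> path_image f" "r \<in> path_image g" using f(3) g(2) by (metis pathfinish_in_path_image, metis pathstart_in_path_image)
    ultimately show ?thesis using pn qn rn p q r by auto
  qed
  have gh: "path_image g \<inter> path_image h \<subseteq> {p}"
  proof -
    have "path_image g \<inter> path_image h \<subseteq> {r, p} \<inter> {p, q}" using h(4,5) g(4,5) nA by blast
    then show ?thesis using pn qn rn p q r by auto
  qed
  have fh: "path_image f \<inter> path_image h \<subseteq> {q}"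
  proof -
    have "path_image f \<inter> path_image h \<subseteq> {q, r} \<inter> {p, q}" using h(4,5) f(4,5) nA by blast
    then show ?thesis using pn qn rn p q r by auto
  qed
  define J where "J = path_image f \<union> path_image g \<union> path_image h"
  define k where "k = (f +++ g) +++ h"
  have afg: "arc (f +++ g)" using f g fg by (intro arc_join) auto
  have "simple_path k" unfolding k_def
  proof (rule simple_path_join_loop[OF afg h(1)])
    show "path_image (f +++ g) \<inter> path_image h \<subseteq> {pathstart (f +++ g), pathstart h}"
    proof -
      have "path_image (f +++ g) = path_image f \<union> path_image g" using f g by (simp add: path_image_join)
      then show ?thesis unfolding pathstart_join f(2) h(2) using gh fh by blast
    qed
  qed (use f g h in auto)
  moreover have "pathfinish k = pathstart k" unfolding k_def using f h by simp
  moreover have kJ: "path_image k = J" unfolding k_def J_def using f g h by (simp add: path_image_join)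
  moreover have JS: "J \<subseteq> S2" unfolding J_def using f(4) g(4) h(4) sa(2) abc pseudocircle_subset by blast
  moreover
  have aJ: "a \<inter> J = path_image f" and bJ: "b \<inter> J = path_image g" and cJ: "c \<inter> J = path_image h"
  proof -
    have "a \<inter> path_image g \<subseteq> {r}" "a \<inter> path_image h \<subseteq> {q}" using g(5) h(5) nA pn by blast+
    moreover have "r \<in> path_image f" "q \<in> path_image f" using f(2,3) by (metis pathfinish_in_path_image, metis pathstart_in_path_image)
    ultimately show "a \<inter> J = path_image f" unfolding J_def using f(4) by blast
    have "b \<inter> path_image f \<subseteq> {r}" "b \<inter> path_image h \<subseteq> {p}" using f(5) h(5) nA qn by blast+
    moreover have "r \<in> path_image g" "p \<in> path_image g" using g(2,3) by (metis pathstart_in_path_image, metis pathfinish_in_path_image)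
    ultimately show "b \<inter> J = path_image g" unfolding J_def using g(4) by blast
    have "c \<inter> path_image f \<subseteq> {q}" "c \<inter> path_image g \<subseteq> {p}" using f(5) g(5) nA rn by blast+
    moreover have "p \<in> path_image h" "q \<in> path_image h" using h(2,3) by (metis pathstart_in_path_image, metis pathfinish_in_path_image)
    ultimately show "c \<inter> J = path_image h" unfolding J_def using h(4) by blast
  qed
  have other: "x \<notin> J" if "x \<in> d" "x \<in> e" "d \<in> A" "e \<in> A" "d \<noteq> e" "x \<notin> {p, q, r}" for x d e
  proof -
    have u: "x \<in> \<Union>(A - {y})" for y using that(1-5) by (cases "y = d") auto
    have "x \<notin> path_image f" "x \<notin> path_image g" "x \<notin> path_image h"
      using u[of a] u[of b] u[of c] f(5) g(5) h(5) that(6) by blast+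
    then show ?thesis unfolding J_def by blast
  qed
  have second: "\<exists>y\<in>d \<inter> e. y \<noteq> x" if "d \<in> A" "e \<in> A" "d \<noteq> e" for d e x
  proof (rule ccontr)
    assume "\<not> ?thesis"
    then have "d \<inter> e \<subseteq> {x}" by blast
    then have "card (d \<inter> e) \<le> 1" using card_mono[of "{x}" "d \<inter> e"] by simp
    then show False using crossing_pair(1)[OF A that] by simp
  qed
  \<comment> \<open>The second crossings of \<open>a\<close> with \<open>b\<close> and with
    \<open>c\<close> lie off \<open>J\<close> and tie together what \<open>J\<close> leaves of the
    three curves.\<close>
  obtain r' where r': "r' \<in> a" "r' \<in> b" "r' \<noteq> r" using second[of a b r] abc by auto
  obtain q' where q': "q' \<in> a" "q' \<in> c" "q' \<noteq> q" using second[of a c q] abc by auto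
  have r'J: "r' \<notin> J" using other[of r' a b] r' abc pn qn by auto
  have q'J: "q' \<notin> J" using other[of q' a c] q' abc pn rn by auto
  have r'S: "r' \<in> S2 - J" using r' r'J sa(2) abc pseudocircle_subset by blast
  ultimately obtain U W where UW: "U \<noteq> W" "components (S2 - J) = {U, W}"
    "closure U = U \<union> J" "closure W = W \<union> J"
    using jordan_curve_sphere[of k J r'] by metis
  define R where "R = \<Union>A - J"
  \<comment> \<open>A fourth curve could meet the free edges only at a vertex, where already two
    curves pass.\<close>
  have dJ: "d \<inter> J = {}" if "d \<in> A" "d \<notin> {a, b, c}" for d
  proof -
    have "p \<notin> d" "q \<notin> d" "r \<notin> d"
      using sa(3)[of b c d p] sa(3)[of a c d q] sa(3)[of a b d r] abc p q r that by auto
    then show ?thesis using f(5) g(5) h(5) that unfolding J_def by blast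
  qed
  have "connected R"
  proof -
    have ca: "connected (a - J)" "connected (b - J)" "connected (c - J)"
    proof -
      have "a - J = a - path_image f" "b - J = b - path_image g" "c - J = c - path_image h"
        using aJ bJ cJ by blast+
      then show "connected (a - J)" "connected (b - J)" "connected (c - J)"
        using connected_pseudocircle_minus_arc[OF sa(2)] abc(1-3) f(1,4) g(1,4) h(1,4) by simp_all
    qed
    have "R = \<Union> ((\<lambda>d. (a - J) \<union> (d - J)) ` A)" unfolding R_def using abc by blast
    moreover have "connected (\<Union> ((\<lambda>d. (a - J) \<union> (d - J)) ` A))"
    proof (rule connected_Union)
      fix X assume "X \<in> (\<lambda>d. (a - J) \<union> (d - J)) ` A"
      then obtain d where d: "d \<in> A" "X = (a - J) \<union> (d - J)" by blast
      consider "d = a" | "d = b" | "d = c" | "d \<notin> {a, b, c}" by blast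
      then show "connected X"
      proof cases
        case 1 then show ?thesis using d ca by simp
      next
        case 2
        have "(a - J) \<inter> (b - J) \<noteq> {}" using r' r'J by blast
        then show ?thesis using d ca 2 connected_Un by metis
      next
        case 3
        have "(a - J) \<inter> (c - J) \<noteq> {}" using q' q'J by blast
        then show ?thesis using d ca 3 connected_Un by metis
      next
        case 4
        have dd: "d - J = d" using dJ[OF d(1) 4] by blast
        obtain z where "z \<in> a" "z \<in> d" using second[of a d] d 4 abc by auto
        then have "(a - J) \<inter> (d - J) \<noteq> {}" using dJ[OF d(1) 4] by blast
        moreover have "connected (d - J)" unfolding dd using connected_pseudocircle sa(2) d(1) by blast
        ultimately show ?thesis using d ca connected_Un by metis
      qed
    next
      show "\<Inter> ((\<lambda>d. (a - J) \<union> (d - J)) ` A) \<noteq> {}" using r' r'J abc by blast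
    qed
    ultimately show ?thesis by simp
  qed
  moreover have "R \<subseteq> S2 - J" unfolding R_def using sa(2) pseudocircle_subset by blast
  moreover have "r' \<in> R" unfolding R_def using r' r'J abc by blast
  ultimately obtain K where K: "K \<in> components (S2 - J)" "R \<subseteq> K"
    using exists_component_superset[of R "S2 - J"] by blast
  obtain F where F: "F \<in> components (S2 - J)" "F \<noteq> K" "closure F = F \<union> J"
    using UW K by (cases "K = U") auto
  have FK: "F \<inter> K = {}" using components_nonoverlap[OF F(1) K(1)] F(2) by blast
  have FA: "F \<inter> \<Union>A = {}"
  proof -
    have "F \<inter> J = {}" using in_components_subset[OF F(1)] by blast
    then show ?thesis using FK K(2) unfolding R_def by blast
  qed
  have JA: "J \<subseteq> \<Union>A" unfolding J_def using f(4) g(4) h(4) abc by blast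
  \<comment> \<open>\<open>F\<close> is a component of the larger set \<open>S2 - J\<close> and
    misses all curves, so it stays a component when the surrounding set shrinks to the complement of
    the arrangement.\<close>
  have "F \<in> cells A" unfolding cells_def
  proof (rule components_intermediate_subset[OF F(1)])
    show "F \<subseteq> S2 - \<Union>A" using FA in_components_subset[OF F(1)] by blast
    show "S2 - \<Union>A \<subseteq> S2 - J" using JA by blast
  qed
  moreover have cr: "closure F \<inter> crossings A = {p, q, r}"
  proof
    have "x \<in> {p, q, r}" if x: "x \<in> closure F" "x \<in> crossings A" for x
    proof (rule ccontr)
      assume n: "x \<notin> {p, q, r}"
      obtain d e where de: "d \<in> A" "e \<in> A" "d \<noteq> e" "x \<in> d" "x \<in> e" using x unfolding crossings_def by blast
      then have "x \<notin> J" using other[of x d e] n by blast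
      then have "x \<in> F" using x F(3) by blast
      then show False using FA de by blast
    qed
    then show "closure F \<inter> crossings A \<subseteq> {p, q, r}" by blast
    have "{p, q, r} \<subseteq> J" using f(2,3) g(2,3) unfolding J_def by (metis (no_types, lifting) UnCI empty_subsetI insert_subset pathfinish_in_path_image pathstart_in_path_image)
    moreover have "{p, q, r} \<subseteq> crossings A" unfolding crossings_def using p q r abc by auto
    ultimately show "{p, q, r} \<subseteq> closure F \<inter> crossings A" using F(3) by blast
  qed
  moreover have "p \<noteq> q" "p \<noteq> r" "q \<noteq> r" using p q r pn qn rn by blast+
  then have "card {p, q, r} = 3" by simp
  ultimately show ?thesis unfolding triangles_def by (intro bexI[of _ F]) auto
qed

text \<open>Each half of \<open>e\<close> without its ends is connected and avoids \<open>f\<close>,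
  so it stays in one component. The crossing at \<open>x\<close> provides two points of
  \<open>e\<close> in different components, and these must belong to different halves.\<close>

lemma crossing_halves:
  assumes "pseudocircle e" "e \<inter> f = {x, y}" "x \<noteq> y" "crosses_at f e x"
  obtains u w U W where "arc u" "arc w" "pathstart u = x" "pathfinish u = y" "pathstart w = x" "pathfinish w = y"
    "path_image u \<union> path_image w = e" "path_image u \<inter> path_image w = {x, y}"
    "U \<in> components (S2 - f)" "W \<in> components (S2 - f)" "U \<noteq> W"
    "path_image u - {x, y} \<subseteq> U" "path_image w - {x, y} \<subseteq> W"
proof -
  obtain k where k: "simple_path k" "pathfinish k = pathstart k" "path_image k = e"
    using assms(1) unfolding pseudocircle_def by blast
  have "x \<in> path_image k" "y \<in> path_image k" using assms(2) k(3) by blast+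
  then obtain u d where ud: "arc u" "arc d" "pathstart u = x" "pathfinish u = y"
    "pathstart d = y" "pathfinish d = x" "path_image u \<inter> path_image d = {x, y}"
    "path_image u \<union> path_image d = e"
    using exists_double_arc[OF k(1,2), of x y] assms(3) k(3) by metis
  have con: "connected (path_image u - {x, y})" "connected (path_image d - {x, y})"
    using connected_simple_path_endless[OF arc_imp_simple_path[OF ud(1)]]
      connected_simple_path_endless[OF arc_imp_simple_path[OF ud(2)]] ud by (simp_all add: insert_commute)
  have sub: "path_image u - {x, y} \<subseteq> S2 - f" "path_image d - {x, y} \<subseteq> S2 - f"
    using ud(8) assms(2) pseudocircle_subset[OF assms(1)] by blast+
  obtain p q U' W' where pq: "p \<in> e" "q \<in> e" "U' \<in> components (S2 - f)" "W' \<in> components (S2 - f)"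
     "U' \<noteq> W'" "p \<in> U'" "q \<in> W'"
    using assms(4) unfolding crosses_at_def by (meson IntD1 zero_less_one)
  have nf: "p \<notin> f" "q \<notin> f" using pq in_components_subset by blast+
  have pin: "p \<in> (path_image u - {x, y}) \<union> (path_image d - {x, y})"
    and qin: "q \<in> (path_image u - {x, y}) \<union> (path_image d - {x, y})"
    using pq nf ud(8) assms(2) by blast+
  have max: "X \<subseteq> K" if "connected X" "X \<subseteq> S2 - f" "K \<in> components (S2 - f)" "z \<in> X" "z \<in> K" for X K z
    using components_maximal[OF that(3,1,2)] that(4,5) by blast
  have disj: "U' \<inter> W' = {}" using components_nonoverlap[OF pq(3,4)] pq(5) by blast
  have rd: "arc (reversepath d)" "pathstart (reversepath d) = x" "pathfinish (reversepath d) = y"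
    "path_image (reversepath d) = path_image d" using ud by (auto simp: arc_reversepath)
  show ?thesis
  proof (cases "p \<in> path_image u - {x, y}")
    case True
    then have u: "path_image u - {x, y} \<subseteq> U'" using max con(1) sub(1) pq by blast
    then have "q \<in> path_image d - {x, y}" using qin pq disj by blast
    then have "path_image d - {x, y} \<subseteq> W'" using max con(2) sub(2) pq by blast
    then show ?thesis using that[of u "reversepath d" U' W'] ud rd pq u by simp
  next
    case False
    then have p: "p \<in> path_image d - {x, y}" using pin by blast
    then have d: "path_image d - {x, y} \<subseteq> U'" using max con(2) sub(2) pq by blast
    then have "q \<in> path_image u - {x, y}" using qin pq disj by blast
    then have "path_image u - {x, y} \<subseteq> W'" using max con(1) sub(1) pq by blast
    then show ?thesis using that[of u "reversepath d" W' U'] ud rd pq d by simp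
  qed
qed

text \<open>Crossing is a local notion. In a ball around \<open>u t\<close> that avoids the rest
  \<open>w\<close> of the curve, the two points in different components must come from
  \<open>u\<close>, one before and one after \<open>t\<close>; connectedness of the two parts of
  \<open>u\<close> makes the conclusion global.\<close>

lemma crosses_once_sides:
  assumes u: "arc u" "path_image u \<union> w = e" and w: "closed w" and eS: "e \<subseteq> S2"
    and t: "0 < t" "t < 1" and once: "\<And>s. s \<in> {0..1} \<Longrightarrow> u s \<in> d \<longleftrightarrow> s = t"
    and uw: "u t \<notin> w" and cr: "crosses_at d e (u t)"
  obtains U W where "U \<in> components (S2 - d)" "W \<in> components (S2 - d)" "U \<noteq> W"
    "u ` {0..<t} \<subseteq> U" "u ` {t<..1} \<subseteq> W"
proof -
  have "open (- w)" "u t \<in> - w" using w uw by auto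
  then obtain r where r0: "r > 0" "ball (u t) r \<subseteq> - w" by (rule openE)
  then have r: "r > 0" "ball (u t) r \<inter> w = {}" by blast+
  obtain p q U' W' where pq: "p \<in> e \<inter> ball (u t) r" "q \<in> e \<inter> ball (u t) r" "U' \<in> components (S2 - d)" "W' \<in> components (S2 - d)"
     "U' \<noteq> W'" "p \<in> U'" "q \<in> W'"
    using cr r(1) unfolding crosses_at_def by meson
  have nf: "p \<notin> d" "q \<notin> d" using pq in_components_subset by blast+
  have im: "z \<in> u ` {0..<t} \<union> u ` {t<..1}" if "z \<in> e \<inter> ball (u t) r" "z \<notin> d" for z
  proof -
    have "z \<in> path_image u" using that(1) u(2) r(2) by blast
    then obtain s where s: "s \<in> {0..1}" "z = u s" unfolding path_image_def by blast
    then have "s \<noteq> t" using that(2) once by blast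
    then show ?thesis using s by (cases "s < t") auto
  qed
  have cu: "continuous_on {0..1} u" using u(1) by (simp add: arc_def path_def)
  have con: "connected (u ` {0..<t})" "connected (u ` {t<..1})"
    using t by (intro connected_continuous_image continuous_on_subset[OF cu]; auto)+
  have sub: "u ` {0..<t} \<subseteq> S2 - d" "u ` {t<..1} \<subseteq> S2 - d"
    using t once u(2) eS unfolding path_image_def by fastforce+
  have max: "X \<subseteq> K" if "connected X" "X \<subseteq> S2 - d" "K \<in> components (S2 - d)" "z \<in> X" "z \<in> K" for X K z
    using components_maximal[OF that(3,1,2)] that(4,5) by blast
  have disj: "U' \<inter> W' = {}" using components_nonoverlap[OF pq(3,4)] pq(5) by blast
  show ?thesis
  proof (cases "p \<in> u ` {0..<t}")
    case True
    then have U: "u ` {0..<t} \<subseteq> U'" using max con(1) sub(1) pq by blast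
    then have "q \<in> u ` {t<..1}" using im[OF pq(2) nf(2)] pq disj by blast
    then have "u ` {t<..1} \<subseteq> W'" using max con(2) sub(2) pq by blast
    then show ?thesis using that pq U by blast
  next
    case False
    then have "p \<in> u ` {t<..1}" using im[OF pq(1) nf(1)] by blast
    then have U: "u ` {t<..1} \<subseteq> U'" using max con(2) sub(2) pq by blast
    then have "q \<in> u ` {0..<t}" using im[OF pq(2) nf(2)] pq disj by blast
    then have "u ` {0..<t} \<subseteq> W'" using max con(1) sub(1) pq by blast
    then show ?thesis using that pq U by blast
  qed
qed

section \<open>Chords and the chirotope of a side\<close>

text \<open>The change of sides is demanded separately, since meeting \<open>d\<close> in a single
  point would also allow the arc to touch it and return.\<close>

definition passes :: "(real^3) set \<Rightarrow> (real \<Rightarrow> real^3) \<Rightarrow> real \<Rightarrow> bool" where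
  "passes d g t \<longleftrightarrow> 0 < t \<and> t < 1 \<and> (\<forall>s\<in>{0..1}. g s \<in> d \<longleftrightarrow> s = t) \<and>
     (\<exists>U\<in>components (S2 - d). \<exists>W\<in>components (S2 - d). U \<noteq> W \<and> g ` {0..<t} \<subseteq> U \<and> g ` {t<..1} \<subseteq> W)"

locale separated_arrangement =
  fixes A :: "(real^3) set set" and C :: "(real^3) set"
  assumes simple: "simple_arrangement A"
    and intersecting: "pairwise_intersecting A"
    and C_in: "C \<in> A"
    and card_ge_3: "card A \<ge> 3"
    and separated: "\<lbrakk>a \<in> A; b \<in> A; a \<noteq> C; b \<noteq> C; a \<noteq> b; p \<in> a \<inter> b; q \<in> a \<inter> b; p \<noteq> q\<rbrakk> \<Longrightarrow>
      \<exists>U\<in>components (S2 - C). \<exists>W\<in>components (S2 - C). U \<noteq> W \<and> p \<in> U \<and> q \<in> W"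
begin

lemmas sa = simple_arrangementD[OF simple]
lemmas crossing = crossing_pair[OF simple intersecting]

text \<open>Another curve crosses \<open>d\<close>, and this supplies a point of the sphere off
  \<open>d\<close>, which \<open>two_sides\<close> needs.\<close>

lemma two_components:
  assumes d: "d \<in> A"
  obtains U W where "U \<noteq> W" "components (S2 - d) = {U, W}" "closure U = U \<union> d" "closure W = W \<union> d"
proof -
  have "\<exists>e\<in>A. e \<noteq> d"
  proof (rule ccontr)
    assume "\<not> ?thesis"
    then have "A \<subseteq> {d}" by blast
    then have "card A \<le> 1" using card_mono[of "{d}" A] by simp
    then show False using card_ge_3 by simp
  qed
  then obtain e where e: "e \<in> A" "e \<noteq> d" by blast
  obtain p where p: "p \<in> d" "p \<in> e" using crossing(1)[OF d e(1)] e(2) by (metis card.empty disjoint_iff zero_neq_numeral)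
  have "crosses_at d e p" using crossing(2)[OF d e(1) _ p] e(2) by blast
  then obtain x K where "x \<in> K" "K \<in> components (S2 - d)" unfolding crosses_at_def by (meson zero_less_one)
  then have "x \<in> S2 - d" using in_components_subset by blast
  then show ?thesis using two_sides[OF sa(2)[OF d]] that by metis
qed

lemma component_cases:
  assumes "d \<in> A" "K \<in> components (S2 - d)" "L \<in> components (S2 - d)" "K \<noteq> L" "M \<in> components (S2 - d)"
  shows "M = K \<or> M = L"
  using two_components[OF assms(1)] assms(2-5) by (metis insertE singletonD)

lemma crossing_points:
  assumes "a \<in> A" "b \<in> A" "a \<noteq> b"
  obtains x y where "a \<inter> b = {x, y}" "x \<noteq> y"
  using crossing(1)[OF assms] by (meson card_2_iff)

lemma crossing_points':
  assumes "a \<in> A" "b \<in> A" "a \<noteq> b" "x \<in> a" "x \<in> b"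
  obtains y where "a \<inter> b = {x, y}" "x \<noteq> y"
proof -
  obtain u v where uv: "a \<inter> b = {u, v}" "u \<noteq> v" using crossing_points[OF assms(1-3)] .
  then have "x = u \<or> x = v" using assms by blast
  then show ?thesis using uv that[of v] that[of u] by (metis insert_commute)
qed

text \<open>Here the hypothesis on \<open>C\<close> enters: it puts the two crossings of
  \<open>a\<close> and \<open>b\<close> into different components of \<open>S2 - C\<close>, and
  there are only two components.\<close>

lemma vertex_in_side:
  assumes ab: "a \<in> A" "b \<in> A" "a \<noteq> C" "b \<noteq> C" "a \<noteq> b" and U: "U \<in> components (S2 - C)"
  obtains p where "a \<inter> b \<inter> U = {p}"
proof -
  obtain x y where xy: "a \<inter> b = {x, y}" "x \<noteq> y" using crossing_points[OF ab(1,2,5)] .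
  then have "x \<in> a \<inter> b" "y \<in> a \<inter> b" by blast+
  then obtain K L where KL: "K \<in> components (S2 - C)" "L \<in> components (S2 - C)" "K \<noteq> L" "x \<in> K" "y \<in> L"
    using separated[OF ab _ _ xy(2)] by blast
  have "K \<inter> L = {}" using components_nonoverlap[OF KL(1,2)] KL(3) by blast
  then have "x \<notin> L" "y \<notin> K" using KL(4,5) by blast+
  moreover have "U = K \<or> U = L" using component_cases[OF C_in KL(1-3) U] .
  ultimately have "a \<inter> b \<inter> U = {x} \<or> a \<inter> b \<inter> U = {y}" unfolding xy(1) using KL(4,5) by auto
  then show ?thesis using that by blast
qed

text \<open>\<open>C\<close> splits \<open>a\<close> into two halves, and the one inside
  \<open>U\<close> is the chord. Another curve \<open>d\<close> meets it once: simplicity keeps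
  \<open>d\<close> away from its ends, and \<open>vertex_in_side\<close> leaves a single crossing in
  \<open>U\<close>.\<close>

lemma chord:
  assumes a: "a \<in> A" "a \<noteq> C" and x: "x \<in> a" "x \<in> C" and U: "U \<in> components (S2 - C)"
  obtains h where "arc h" "path_image h \<subseteq> a" "h 0 = x" "a \<inter> C = {h 0, h 1}"
    "\<And>s. 0 < s \<Longrightarrow> s < 1 \<Longrightarrow> h s \<in> U"
    "\<And>d. d \<in> A \<Longrightarrow> d \<noteq> C \<Longrightarrow> d \<noteq> a \<Longrightarrow> \<exists>t. passes d h t"
proof -
  obtain y where xy: "a \<inter> C = {x, y}" "x \<noteq> y" using crossing_points'[OF a(1) C_in a(2) x] .
  have cr: "crosses_at C a x" using crossing(2)[OF C_in a(1) _ x(2,1)] a(2) by blast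
  obtain u w U' W' where uw: "arc u" "arc w" "pathstart u = x" "pathfinish u = y" "pathstart w = x" "pathfinish w = y"
    "path_image u \<union> path_image w = a" "path_image u \<inter> path_image w = {x, y}"
    "U' \<in> components (S2 - C)" "W' \<in> components (S2 - C)" "U' \<noteq> W'"
    "path_image u - {x, y} \<subseteq> U'" "path_image w - {x, y} \<subseteq> W'"
    using crossing_halves[OF sa(2)[OF a(1)] xy cr] .
  have "\<exists>h k V. arc h \<and> arc k \<and> pathstart h = x \<and> pathfinish h = y \<and> path_image h \<union> path_image k = a \<and>
     path_image h - {x, y} \<subseteq> U \<and> path_image k - {x, y} \<subseteq> V \<and> V \<inter> U = {}"
  proof (cases "U = U'")
    case True
    then show ?thesis using uw components_nonoverlap[OF uw(9,10)] by (metis inf_commute)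
  next
    case False
    then have "U = W'" using component_cases[OF C_in uw(9-11) U] by blast
    then show ?thesis using uw components_nonoverlap[OF uw(9,10)] by (metis sup_commute)
  qed
  then obtain h k V where hk: "arc h" "arc k" "pathstart h = x" "pathfinish h = y" "path_image h \<union> path_image k = a"
     "path_image h - {x, y} \<subseteq> U" "path_image k - {x, y} \<subseteq> V" "V \<inter> U = {}" by blast
  have h01: "h 0 = x" "h 1 = y" using hk(3,4) by (simp_all add: pathstart_def pathfinish_def)
  have inj: "inj_on h {0..1}" using hk(1) by (simp add: arc_def)
  have inU: "h s \<in> U" if "0 < s" "s < 1" for s
  proof -
    have "h s \<noteq> x" "h s \<noteq> y" using inj_onD[OF inj, of s 0] inj_onD[OF inj, of s 1] that h01 by auto
    moreover have "h s \<in> path_image h" using that unfolding path_image_def by auto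
    ultimately show ?thesis using hk(6) by blast
  qed
  have UC: "U \<inter> C = {}" using in_components_subset[OF U] by blast
  have "\<exists>t. passes d h t" if d: "d \<in> A" "d \<noteq> C" "d \<noteq> a" for d
  proof -
    obtain v where v: "a \<inter> d \<inter> U = {v}" using vertex_in_side[OF a(1) d(1) a(2) d(2) _ U] d(3) by blast
    have ends: "x \<notin> d" "y \<notin> d" using sa(3)[OF a(1) C_in d(1)] a(2) d xy by auto
    have "v \<notin> path_image k"
    proof
      assume "v \<in> path_image k"
      moreover have "v \<notin> {x, y}" using v xy UC by blast
      ultimately show False using hk(7,8) v by blast
    qed
    moreover have "v \<in> path_image h" using v hk(5) calculation by blast
    then obtain t where t: "t \<in> {0..1}" "v = h t" unfolding path_image_def by blast
    have "t \<noteq> 0" "t \<noteq> 1" using t h01 v ends by auto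
    then have t': "0 < t" "t < 1" using t by auto
    have once: "h s \<in> d \<longleftrightarrow> s = t" if s: "s \<in> {0..1}" for s
    proof
      assume "h s \<in> d"
      moreover have "h s \<in> a" using s hk(5) unfolding path_image_def by blast
      moreover have "s \<noteq> 0" "s \<noteq> 1" using calculation h01 ends by auto
      then have "h s \<in> U" using inU[of s] s by auto
      ultimately have "h s = v" using v by blast
      then show "s = t" using inj_onD[OF inj, of s t] s t by simp
    next
      assume "s = t" then show "h s \<in> d" using t v by blast
    qed
    have "crosses_at d a (h t)" using crossing(2)[OF d(1) a(1) d(3), of v] v t by blast
    then obtain K L where "K \<in> components (S2 - d)" "L \<in> components (S2 - d)" "K \<noteq> L"
      "h ` {0..<t} \<subseteq> K" "h ` {t<..1} \<subseteq> L"
      using crosses_once_sides[OF hk(1,5) closed_arc_image[OF hk(2)] pseudocircle_subset[OF sa(2)[OF a(1)]] t' once]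
        calculation t(2) by metis
    then show ?thesis unfolding passes_def using t' once by blast
  qed
  moreover have "path_image h \<subseteq> a" using hk(5) by blast
  ultimately show ?thesis using that[of h] hk(1) h01 xy(1) inU by blast
qed

text \<open>The chord of \<open>a\<close> from \<open>x\<close> to \<open>y\<close> crosses
  \<open>d\<close> exactly once and so ends on the other side. This is the antipodal behaviour on
  \<open>C\<close> that lets it act as a line at infinity.\<close>

lemma opposite_ends:
  assumes a: "a \<in> A" "a \<noteq> C" and d: "d \<in> A" "d \<noteq> C" "d \<noteq> a" and xy: "a \<inter> C = {x, y}" "x \<noteq> y"
  obtains K L where "K \<in> components (S2 - d)" "L \<in> components (S2 - d)" "K \<noteq> L" "x \<in> K" "y \<in> L"
proof -
  obtain U where U: "U \<in> components (S2 - C)" using two_components[OF C_in] by (metis insertI1)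
  have x: "x \<in> a" "x \<in> C" using xy by blast+
  obtain h where h: "h 0 = x" "a \<inter> C = {h 0, h 1}" "\<And>d. d \<in> A \<Longrightarrow> d \<noteq> C \<Longrightarrow> d \<noteq> a \<Longrightarrow> \<exists>t. passes d h t"
    using chord[OF a x U] by metis
  have h1: "h 1 = y" using h(1,2) xy by (metis doubleton_eq_iff)
  obtain t where "passes d h t" using h(3)[OF d] by blast
  then obtain K L where KL: "K \<in> components (S2 - d)" "L \<in> components (S2 - d)" "K \<noteq> L" "0 < t" "t < 1"
    "h ` {0..<t} \<subseteq> K" "h ` {t<..1} \<subseteq> L" unfolding passes_def by blast
  have "h 0 \<in> K" "h 1 \<in> L" using KL(4-7) by auto
  then show ?thesis using that KL(1-3) h(1) h1 by blast
qed

text \<open>The two arcs into which \<open>r\<close> cuts \<open>C\<close> lie on different sides of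
  \<open>r\<close>. By \<open>opposite_ends\<close>, with \<open>d\<close> supplying the chord and
  \<open>r\<close> as the curve it crosses, the two points of \<open>d\<close> on \<open>C\<close>
  are also on different sides of \<open>r\<close>. Hence \<open>d\<close> meets each arc
  once.\<close>

lemma C_halves:
  assumes r: "r \<in> A" "r \<noteq> C"
  obtains g g' K K' where "arc g" "arc g'" "path_image g \<union> path_image g' = C" "g' 0 = g 0" "g' 1 = g 1"
    "C \<inter> r = {g 0, g 1}" "K \<in> components (S2 - r)" "K' \<in> components (S2 - r)" "K \<noteq> K'"
    "\<And>s. 0 < s \<Longrightarrow> s < 1 \<Longrightarrow> g s \<in> K" "\<And>s. 0 < s \<Longrightarrow> s < 1 \<Longrightarrow> g' s \<in> K'"
    "\<And>d. d \<in> A \<Longrightarrow> d \<noteq> C \<Longrightarrow> d \<noteq> r \<Longrightarrow> \<exists>t. passes d g t"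
    "\<And>d. d \<in> A \<Longrightarrow> d \<noteq> C \<Longrightarrow> d \<noteq> r \<Longrightarrow> \<exists>t. passes d g' t"
proof -
  obtain x y where xy: "C \<inter> r = {x, y}" "x \<noteq> y" using crossing_points[OF C_in r(1)] r(2) by metis
  have x: "x \<in> r" "x \<in> C" using xy by blast+
  have cr: "crosses_at r C x" using crossing(2)[OF r(1) C_in r(2) x] .
  obtain u w U W where uw: "arc u" "arc w" "pathstart u = x" "pathfinish u = y" "pathstart w = x" "pathfinish w = y"
    "path_image u \<union> path_image w = C" "path_image u \<inter> path_image w = {x, y}"
    "U \<in> components (S2 - r)" "W \<in> components (S2 - r)" "U \<noteq> W"
    "path_image u - {x, y} \<subseteq> U" "path_image w - {x, y} \<subseteq> W"
    using crossing_halves[OF sa(2)[OF C_in] xy cr] .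
  have UW: "U \<inter> W = {}" using components_nonoverlap[OF uw(9,10)] uw(11) by blast
  have interior: "g s \<in> X" if "arc g" "pathstart g = x" "pathfinish g = y" "path_image g - {x, y} \<subseteq> X" "0 < s" "s < 1" for g s X
  proof -
    have inj: "inj_on g {0..1}" using that(1) by (simp add: arc_def)
    have "g s \<noteq> x" "g s \<noteq> y" using inj_onD[OF inj, of s 0] inj_onD[OF inj, of s 1] that
      unfolding pathstart_def pathfinish_def by auto
    moreover have "g s \<in> path_image g" using that unfolding path_image_def by auto
    ultimately show ?thesis using that(4) by blast
  qed
  have ex: "\<exists>t. passes d g t"
    if g: "arc g" "arc g'" "pathstart g = x" "pathfinish g = y" "path_image g \<union> path_image g' = C"
      "path_image g - {x, y} \<subseteq> X" "path_image g' - {x, y} \<subseteq> X'" "X \<in> components (S2 - r)" "X' \<in> components (S2 - r)" "X \<inter> X' = {}"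
      and d: "d \<in> A" "d \<noteq> C" "d \<noteq> r" for g g' X X' d
  proof -
    obtain z z' where z: "d \<inter> C = {z, z'}" "z \<noteq> z'" using crossing_points[OF d(1) C_in d(2)] .
    have ends: "x \<notin> d" "y \<notin> d" using sa(3)[OF C_in r(1) d(1)] d r xy by auto
    obtain P Q where PQ: "P \<in> components (S2 - r)" "Q \<in> components (S2 - r)" "P \<noteq> Q" "z \<in> P" "z' \<in> Q"
      using opposite_ends[OF d(1,2) r d(3)[symmetric] z] .
    have PQd: "P \<inter> Q = {}" using components_nonoverlap[OF PQ(1,2)] PQ(3) by blast
    have XX: "X \<noteq> X'" using g(8,10) in_components_nonempty by blast
    have zin: "z \<in> (path_image g - {x, y}) \<union> (path_image g' - {x, y})" "z' \<in> (path_image g - {x, y}) \<union> (path_image g' - {x, y})"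
      using z g(5) ends by blast+
    have PX: "P = X \<or> P = X'" "Q = X \<or> Q = X'" using component_cases[OF r(1) g(8,9) XX] PQ by blast+
    have "\<exists>v. d \<inter> C \<inter> (path_image g - {x, y}) = {v} \<and> v \<notin> path_image g'"
    proof (cases "P = X")
      case True
      then have "Q = X'" using PX PQ by blast
      then have "z \<notin> X'" "z' \<notin> X" using PQ(4,5) True g(10) by blast+
      then have "z \<in> path_image g - {x, y}" "z' \<notin> path_image g - {x, y}" "z \<notin> path_image g' - {x, y}"
        using zin g(6,7) by blast+
      moreover have "z \<notin> {x, y}" using z ends by blast
      ultimately show ?thesis unfolding z(1) by blast
    next
      case False
      then have "P = X'" "Q = X" using PX PQ by blast+
      then have "z' \<notin> X'" "z \<notin> X" using PQ(4,5) g(10) by blast+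
      then have "z' \<in> path_image g - {x, y}" "z \<notin> path_image g - {x, y}" "z' \<notin> path_image g' - {x, y}"
        using zin g(6,7) by blast+
      moreover have "z' \<notin> {x, y}" using z ends by blast
      ultimately show ?thesis unfolding z(1) by blast
    qed
    then obtain v where v: "d \<inter> C \<inter> (path_image g - {x, y}) = {v}" "v \<notin> path_image g'" by blast
    then obtain t where t: "t \<in> {0..1}" "v = g t" unfolding path_image_def by blast
    have inj: "inj_on g {0..1}" using g(1) by (simp add: arc_def)
    have g01: "g 0 = x" "g 1 = y" using g by (simp_all add: pathstart_def pathfinish_def)
    have "t \<noteq> 0" "t \<noteq> 1" using t g01 v ends by auto
    then have t': "0 < t" "t < 1" using t by auto
    have once: "g s \<in> d \<longleftrightarrow> s = t" if s: "s \<in> {0..1}" for s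
    proof
      assume "g s \<in> d"
      moreover have "g s \<in> path_image g" using s unfolding path_image_def by blast
      moreover have "g s \<notin> {x, y}" using calculation ends by blast
      ultimately have "g s = v" using v g(5) by blast
      then show "s = t" using inj_onD[OF inj, of s t] s t by simp
    next
      assume "s = t" then show "g s \<in> d" using t v by blast
    qed
    have "crosses_at d C (g t)" using crossing(2)[OF d(1) C_in d(2), of v] v t by blast
    then obtain K L where "K \<in> components (S2 - d)" "L \<in> components (S2 - d)" "K \<noteq> L"
      "g ` {0..<t} \<subseteq> K" "g ` {t<..1} \<subseteq> L"
      using crosses_once_sides[OF g(1,5) closed_arc_image[OF g(2)] pseudocircle_subset[OF sa(2)[OF C_in]] t' once]
        v(2) t(2) by metis
    then show ?thesis unfolding passes_def using t' once by blast
  qed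
  have e1: "\<exists>t. passes d u t" if "d \<in> A" "d \<noteq> C" "d \<noteq> r" for d
    using ex[OF uw(1,2,3,4,7,12,13,9,10) UW that] .
  have e2: "\<exists>t. passes d w t" if "d \<in> A" "d \<noteq> C" "d \<noteq> r" for d
    using ex[OF uw(2,1,5,6) _ uw(13,12,10,9) _ that] uw(7) UW by (simp add: Un_commute Int_commute)
  have ends: "w 0 = u 0" "w 1 = u 1" "u 0 = x" "u 1 = y" using uw(3-6) by (simp_all add: pathstart_def pathfinish_def)
  show ?thesis
    by (rule that[OF uw(1,2,7) ends(1,2) _ uw(9-11) interior[OF uw(1,3,4,12)] interior[OF uw(2,5,6,13)] e1 e2])
      (simp_all add: ends xy)
qed

end

text \<open>The arc \<open>h e\<close> is the chord cut out of \<open>e\<close> by \<open>U\<close>; for \<open>e = C\<close> it is one of the two arcs into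
  which \<open>r\<close> cuts \<open>C\<close>, the other one being \<open>g'\<close>. The parameter of the crossing with \<open>d\<close> is \<open>tau e d\<close>.
  One curve (\<open>C\<close> for a chord, \<open>r\<close> for \<open>C\<close>) is met at both ends of \<open>h e\<close>, and \<open>tau\<close> records the
  start.\<close>

locale side_charts = separated_arrangement A C for A C +
  fixes U r :: "(real^3) set" and h :: "(real^3) set \<Rightarrow> real \<Rightarrow> real^3"
    and tau :: "(real^3) set \<Rightarrow> (real^3) set \<Rightarrow> real" and g' :: "real \<Rightarrow> real^3" and K K' :: "(real^3) set"
  assumes U: "U \<in> components (S2 - C)"
    and r: "r \<in> A" "r \<noteq> C"
    and arc_h: "e \<in> A \<Longrightarrow> arc (h e)" "e \<in> A \<Longrightarrow> path_image (h e) \<subseteq> e"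
    and g': "arc g'" "path_image (h C) \<union> path_image g' = C" "g' 0 = h C 0" "g' 1 = h C 1"
    and C_r: "C \<inter> r = {h C 0, h C 1}"
    and K: "K \<in> components (S2 - r)" "K' \<in> components (S2 - r)" "K \<noteq> K'"
    and C_interior: "\<lbrakk>0 < s; s < 1\<rbrakk> \<Longrightarrow> h C s \<in> K" "\<lbrakk>0 < s; s < 1\<rbrakk> \<Longrightarrow> g' s \<in> K'"
    and chord_start: "\<lbrakk>a \<in> A; a \<noteq> C\<rbrakk> \<Longrightarrow> h a 0 = h C (tau C a)"
    and chord_ends: "\<lbrakk>a \<in> A; a \<noteq> C\<rbrakk> \<Longrightarrow> a \<inter> C = {h a 0, h a 1}"
    and chord_interior: "\<lbrakk>a \<in> A; a \<noteq> C; 0 < s; s < 1\<rbrakk> \<Longrightarrow> h a s \<in> U"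
    and tau_0: "tau C r = 0" "\<lbrakk>a \<in> A; a \<noteq> C\<rbrakk> \<Longrightarrow> tau a C = 0"
    and passes_h: "\<lbrakk>e \<in> A; d \<in> A; d \<noteq> e; d \<noteq> (if e = C then r else C)\<rbrakk> \<Longrightarrow> passes d (h e) (tau e d)"
    and passes_g': "\<lbrakk>d \<in> A; d \<noteq> C; d \<noteq> r\<rbrakk> \<Longrightarrow> \<exists>t. passes d g' t"
begin

section \<open>Signs of sides and the chirotope axioms\<close>

definition first :: "(real^3) set \<Rightarrow> (real^3) set" where
  "first e = (if e = C then r else C)"

text \<open>For curves other than \<open>C\<close> and \<open>r\<close> the positive side is that of
  the base point \<open>h C 0\<close>. The curve \<open>r\<close> runs through this point; with
  \<open>K'\<close> as its positive side, the arc \<open>h C\<close> looks as if it came from there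
  and crossed \<open>r\<close> at parameter \<open>0\<close>.\<close>

definition pos :: "(real^3) set \<Rightarrow> (real^3) set" where
  "pos d = (if d = C then U else if d = r then K' else connected_component_set (S2 - d) (h C 0))"

definition side :: "(real^3) set \<Rightarrow> real^3 \<Rightarrow> int" where
  "side d p = (if p \<in> pos d then 1 else - 1)"

text \<open>The values at \<open>first e\<close>, on which \<open>h e 0\<close> lies, are the ones that make \<open>start_side\<close>
  antisymmetric.\<close>

definition start_side :: "(real^3) set \<Rightarrow> (real^3) set \<Rightarrow> int" where
  "start_side e d = (if d = first e then (if e = C then 1 else - 1) else side d (h e 0))"

text \<open>The model is the determinant of three lines, which evaluates \<open>f\<close> at the
  intersection point of \<open>e\<close> and \<open>d\<close>. \<open>side\<close> gives the side of
  \<open>f\<close> on which this point lies, and \<open>start_side\<close> contributes the sign that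
  changes when \<open>e\<close> and \<open>d\<close> are exchanged.\<close>

definition chi :: "(real^3) set \<Rightarrow> (real^3) set \<Rightarrow> (real^3) set \<Rightarrow> int" where
  "chi e d f = start_side e d * side f (h e (tau e d))"

lemma first: "e \<in> A \<Longrightarrow> first e \<in> A" "first e \<noteq> e"
  using C_in r unfolding first_def by auto

lemma tau_first: "e \<in> A \<Longrightarrow> tau e (first e) = 0"
  using tau_0 unfolding first_def by auto

lemma passes_tau: "\<lbrakk>e \<in> A; d \<in> A; d \<noteq> e; d \<noteq> first e\<rbrakk> \<Longrightarrow> passes d (h e) (tau e d)"
  using passes_h[of e d] unfolding first_def by metis

lemma tau_range: "\<lbrakk>e \<in> A; d \<in> A; d \<noteq> e; d \<noteq> first e\<rbrakk> \<Longrightarrow> 0 < tau e d \<and> tau e d < 1"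
  using passes_tau unfolding passes_def by blast

lemma tau_range': "\<lbrakk>e \<in> A; d \<in> A; d \<noteq> e\<rbrakk> \<Longrightarrow> 0 \<le> tau e d \<and> tau e d < 1"
  using tau_range[of e d] tau_first[of e] by (cases "d = first e") auto

lemma h_mem: "\<lbrakk>e \<in> A; 0 \<le> s; s \<le> 1\<rbrakk> \<Longrightarrow> h e s \<in> e"
  using arc_h(2)[of e] unfolding path_image_def by auto

lemma h_tau:
  assumes "e \<in> A" "d \<in> A" "d \<noteq> e"
  shows "h e (tau e d) \<in> e" "h e (tau e d) \<in> d"
proof -
  show "h e (tau e d) \<in> e" using h_mem tau_range'[OF assms] assms by auto
  show "h e (tau e d) \<in> d"
  proof (cases "d = first e")
    case True
    then show ?thesis using assms tau_first[of e] C_r chord_ends[of e] unfolding first_def by (auto split: if_splits)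
  next
    case False
    then show ?thesis using passes_tau[OF assms] unfolding passes_def by auto
  qed
qed

lemma tau_inj:
  assumes "e \<in> A" "d \<in> A" "f \<in> A" "distinct [e, d, f]"
  shows "tau e d \<noteq> tau e f"
  using sa(3)[of e d f "h e (tau e d)"] h_tau[of e d] h_tau[of e f] assms by (metis distinct_length_2_or_more)

lemma h_first_interior: "\<lbrakk>e \<in> A; 0 < s; s < 1\<rbrakk> \<Longrightarrow> h e s \<notin> first e"
  using C_interior(1)[of s] chord_interior[of e s] in_components_subset[OF K(1)] in_components_subset[OF U]
  unfolding first_def by (cases "e = C") auto

lemma base_point: "h C 0 \<in> C" "h C 0 \<in> r"
  using C_r by blast+

lemma pos_component:
  assumes "d \<in> A"
  shows "pos d \<in> components (S2 - d)"
proof (cases "d = C \<or> d = r")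
  case True
  then show ?thesis using U K unfolding pos_def by auto
next
  case False
  then have "h C 0 \<notin> d" using sa(3)[OF C_in r(1) assms] r base_point by auto
  moreover have "h C 0 \<in> S2" using base_point pseudocircle_subset[OF sa(2)[OF C_in]] by blast
  ultimately show ?thesis using False unfolding pos_def components_def by auto
qed

lemma side_base: "\<lbrakk>d \<in> A; d \<noteq> C; d \<noteq> r\<rbrakk> \<Longrightarrow> side d (h C 0) = 1"
proof -
  assume d: "d \<in> A" "d \<noteq> C" "d \<noteq> r"
  then have "h C 0 \<notin> d" using sa(3)[OF C_in r(1), of d] r base_point by auto
  moreover have "h C 0 \<in> S2" using base_point pseudocircle_subset[OF sa(2)[OF C_in]] by blast
  ultimately show ?thesis using d unfolding side_def pos_def by (simp add: connected_component_refl_eq)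
qed

lemma side_values: "side d p = 1 \<or> side d p = - 1"
  unfolding side_def by simp

lemma side_same:
  assumes "d \<in> A" "M \<in> components (S2 - d)" "p \<in> M" "q \<in> M"
  shows "side d p = side d q"
  using components_nonoverlap[OF assms(2) pos_component[OF assms(1)]] assms(3,4)
  unfolding side_def by auto

lemma side_opposite:
  assumes "d \<in> A" "M \<in> components (S2 - d)" "N \<in> components (S2 - d)" "M \<noteq> N" "p \<in> M" "q \<in> N"
  shows "side d q = - side d p"
proof -
  have "M \<inter> N = {}" using components_nonoverlap[OF assms(2,3)] assms(4) by blast
  moreover have "pos d = M \<or> pos d = N" using component_cases[OF assms(1-4) pos_component[OF assms(1)]] .
  ultimately show ?thesis using assms(5,6) unfolding side_def by auto
qed

lemma side_passes:
  assumes "d \<in> A" "passes d g t"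
  shows "\<lbrakk>0 \<le> s; s < t; t < s'; s' \<le> 1\<rbrakk> \<Longrightarrow> side d (g s') = - side d (g s)"
    and "\<lbrakk>0 \<le> s; s < t; 0 \<le> s'; s' < t\<rbrakk> \<Longrightarrow> side d (g s') = side d (g s)"
proof -
  obtain M N where MN: "M \<in> components (S2 - d)" "N \<in> components (S2 - d)" "M \<noteq> N"
    "g ` {0..<t} \<subseteq> M" "g ` {t<..1} \<subseteq> N"
    using assms(2) unfolding passes_def by blast
  show "side d (g s') = - side d (g s)" if "0 \<le> s" "s < t" "t < s'" "s' \<le> 1"
    by (rule side_opposite[OF assms(1) MN(1-3)]) (use MN(4,5) that in auto)
  show "side d (g s') = side d (g s)" if "0 \<le> s" "s < t" "0 \<le> s'" "s' < t"
    by (rule side_same[OF assms(1) MN(1)]) (use MN(4) that in auto)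
qed

text \<open>After its start on \<open>first e\<close> the arc stays on one side of that curve. The
  minus sign makes the start count as a crossing at parameter \<open>0\<close>, so that later
  arguments can treat \<open>first e\<close> like any other curve.\<close>

lemma side_first:
  assumes "e \<in> A" "0 < s" "s < 1"
  shows "side (first e) (h e s) = - start_side e (first e)"
proof (cases "e = C")
  case True
  have "K \<inter> K' = {}" using components_nonoverlap[OF K(1,2)] K(3) by blast
  then have "h C s \<notin> K'" using C_interior(1)[OF assms(2,3)] by blast
  then show ?thesis using True r unfolding start_side_def first_def side_def pos_def by auto
next
  case False
  then show ?thesis using chord_interior[OF assms(1) _ assms(2,3)]
    unfolding start_side_def first_def side_def pos_def by auto
qed

lemma start_side_values: "start_side e d = 1 \<or> start_side e d = - 1"
  using side_values unfolding start_side_def by auto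

text \<open>Along \<open>h e\<close> the side of \<open>f\<close> changes only at
  \<open>tau e f\<close>, so it is known from its value at the start and the order of the
  parameters. This reduces the chirotope to orders of crossings along arcs.\<close>

lemma side_vertex:
  assumes "e \<in> A" "d \<in> A" "f \<in> A" "distinct [e, d, f]"
  shows "side f (h e (tau e d)) = start_side e f * (if tau e d < tau e f then 1 else - 1)"
proof (cases "f = first e")
  case True
  then have "0 < tau e d \<and> tau e d < 1" using tau_range[of e d] assms by auto
  then show ?thesis using side_first[OF assms(1), of "tau e d"] True tau_first[OF assms(1)] by simp
next
  case False
  have p: "passes f (h e) (tau e f)" using passes_tau[of e f] assms False by auto
  have "d \<noteq> e" "f \<noteq> e" using assms(4) by (metis distinct_length_2_or_more)+
  then have t: "0 \<le> tau e d" "tau e d \<le> 1" "0 < tau e f"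
    using tau_range'[OF assms(1,2)] tau_range[OF assms(1,3)] False by simp_all
  show ?thesis using tau_inj[OF assms] side_passes(1)[OF assms(3) p, of 0 "tau e d"]
      side_passes(2)[OF assms(3) p, of 0 "tau e d"] t False unfolding start_side_def by auto
qed

text \<open>The chord of \<open>a\<close> starts at parameter \<open>tau C a\<close> of
  \<open>h C\<close>, and \<open>h C\<close> leaves the positive side of \<open>b\<close> at
  \<open>tau C b\<close>. Comparing two reals in this way yields the antisymmetry of
  \<open>start_side\<close>.\<close>

lemma start_side_chords:
  assumes "a \<in> A" "b \<in> A" "a \<noteq> C" "b \<noteq> C" "a \<noteq> b"
  shows "start_side a b = (if tau C a < tau C b then 1 else - 1)"
proof -
  have ss: "start_side a b = side b (h C (tau C a))"
    using assms chord_start[of a] unfolding start_side_def first_def by simp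
  show ?thesis
  proof (cases "b = r")
    case True
    then have "0 < tau C a \<and> tau C a < 1" using tau_range[of C a] C_in assms unfolding first_def by auto
    then show ?thesis using ss side_first[OF C_in, of "tau C a"] True tau_0(1)
      unfolding first_def start_side_def by simp
  next
    case False
    have p: "passes b (h C) (tau C b)" using passes_tau[of C b] assms False C_in unfolding first_def by auto
    have t: "0 \<le> tau C a" "tau C a \<le> 1" "0 < tau C b"
      using tau_range'[of C a] tau_range[of C b] assms False C_in unfolding first_def by auto
    show ?thesis using tau_inj[of C a b] assms C_in side_passes(1)[OF assms(2) p, of 0 "tau C a"]
      side_passes(2)[OF assms(2) p, of 0 "tau C a"] t side_base[OF assms(2,4) False] ss by auto
  qed
qed

lemma start_side_C:
  assumes "a \<in> A" "a \<noteq> C"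
  shows "start_side a C = - 1" "start_side C a = 1"
  using assms side_base[of a] unfolding start_side_def first_def by auto

lemma start_side_antisym:
  assumes "e \<in> A" "d \<in> A" "e \<noteq> d"
  shows "start_side d e = - start_side e d"
proof -
  consider "e = C" | "d = C" | "e \<noteq> C" "d \<noteq> C" by blast
  then show ?thesis
  proof cases
    case 1 then show ?thesis using start_side_C[of d] assms by auto
  next
    case 2 then show ?thesis using start_side_C[of e] assms by auto
  next
    case 3 then show ?thesis using start_side_chords[of d e] start_side_chords[of e d] tau_inj[of C d e] C_in assms by auto
  qed
qed

lemma vertex_sym:
  assumes "e \<in> A" "d \<in> A" "e \<noteq> d"
  shows "h e (tau e d) = h d (tau d e)"
proof -
  consider "e = C" | "d = C" | "e \<noteq> C" "d \<noteq> C" by blast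
  then show ?thesis
  proof cases
    case 1 then show ?thesis using chord_start[of d] tau_0(2)[of d] assms by auto
  next
    case 2 then show ?thesis using chord_start[of e] tau_0(2)[of e] assms by auto
  next
    case 3
    obtain p where p: "e \<inter> d \<inter> U = {p}" using vertex_in_side[OF assms(1,2) 3 assms(3) U] .
    have "h e (tau e d) \<in> U" "h d (tau d e) \<in> U"
      using chord_interior[of e "tau e d"] chord_interior[of d "tau d e"] tau_range[of e d] tau_range[of d e]
        assms 3 unfolding first_def by auto
    moreover have "h e (tau e d) \<in> e \<inter> d" "h d (tau d e) \<in> e \<inter> d"
      using h_tau[of e d] h_tau[of d e] assms by auto
    ultimately have "h e (tau e d) \<in> e \<inter> d \<inter> U" "h d (tau d e) \<in> e \<inter> d \<inter> U" by blast+
    then show ?thesis unfolding p by simp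
  qed
qed

lemma chi_eq:
  assumes "e \<in> A" "d \<in> A" "f \<in> A" "distinct [e, d, f]"
  shows "chi e d f = start_side e d * start_side e f * (if tau e d < tau e f then 1 else - 1)"
  unfolding chi_def side_vertex[OF assms] by simp

text \<open>\<open>s x y\<close> is the sign of \<open>y - x\<close>, and \<open>(y - x) * (w - z) +
  (z - x) * (y - w) + (w - x) * (z - y) = 0\<close>.\<close>

lemma grassmann_pluecker_reals:
  fixes x y z w :: real
  assumes "distinct [x, y, z, w]"
  defines "s \<equiv> \<lambda>x y :: real. if x < y then 1 else - 1 :: int"
  shows "\<not> (s x y * s z w = s x z * s w y \<and> s x z * s w y = s x w * s y z)"
  using assms(1) unfolding s_def by (auto split: if_splits)

sublocale chirotope A chi
proof
  show "finite A" by (rule sa(1))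
next
  fix a b c assume abc: "a \<in> A" "b \<in> A" "c \<in> A" "distinct [a, b, c]"
  show "chi a b c = 1 \<or> chi a b c = - 1"
    unfolding chi_def using start_side_values[of a b] side_values[of c "h a (tau a b)"] by auto
  show "chi b a c = - chi a b c"
    unfolding chi_def using start_side_antisym[of a b] vertex_sym[of a b] abc by auto
  show "chi a c b = - chi a b c"
  proof -
    have "distinct [a, c, b]" using abc(4) by (metis distinct_length_2_or_more)
    then show ?thesis using chi_eq[OF abc] chi_eq[OF abc(1,3,2)] tau_inj[OF abc] by (simp add: mult_ac)
  qed
next
  fix a b c d e assume abc: "a \<in> A" "b \<in> A" "c \<in> A" "d \<in> A" "e \<in> A" "distinct [a, b, c, d, e]"
  define s where "s = (\<lambda>x y :: real. if x < y then 1 else - 1 :: int)"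
  \<comment> \<open>By \<open>chi_eq\<close> each of the four starting signs at \<open>a\<close>
    occurs exactly once in every one of the three terms, so \<open>E\<close> is a common factor and
    the relation becomes the one for the real parameters.\<close>
  define E where "E = start_side a b * start_side a c * start_side a d * start_side a e"
  have E: "E \<noteq> 0" unfolding E_def
    using start_side_values[of a b] start_side_values[of a c] start_side_values[of a d] start_side_values[of a e] by auto
  have chi: "chi a x y = start_side a x * start_side a y * s (tau a x) (tau a y)"
    if "x \<in> A" "y \<in> A" "distinct [a, x, y]" for x y
    using chi_eq[OF abc(1) that] unfolding s_def .
  have ne: "e \<noteq> c" using abc(6) by (metis distinct_length_2_or_more)
  have 1: "chi a b c * chi a d e = E * (s (tau a b) (tau a c) * s (tau a d) (tau a e))"
    using abc ne by (simp add: chi E_def)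
  have 2: "chi a b d * chi a e c = E * (s (tau a b) (tau a d) * s (tau a e) (tau a c))"
    using abc ne by (simp add: chi E_def)
  have 3: "chi a b e * chi a c d = E * (s (tau a b) (tau a e) * s (tau a c) (tau a d))"
    using abc ne by (simp add: chi E_def)
  have "distinct [tau a b, tau a c, tau a d, tau a e]"
    using tau_inj[of a b c] tau_inj[of a b d] tau_inj[of a b e] tau_inj[of a c d] tau_inj[of a c e] tau_inj[of a d e] abc
    by auto
  from grassmann_pluecker_reals[OF this]
  show "\<not> (chi a b c * chi a d e = chi a b d * chi a e c \<and> chi a b d * chi a e c = chi a b e * chi a c d)"
    unfolding 1 2 3 using E unfolding s_def by simp
qed

section \<open>From equal signs at the vertices to triangular cells\<close>

lemma arc_free_edge:
  assumes g: "arc g" "path_image g \<subseteq> e" and st: "s \<in> {0..1}" "t \<in> {0..1}" "s \<noteq> t"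
    and free: "\<And>d. \<lbrakk>d \<in> A; d \<noteq> e\<rbrakk> \<Longrightarrow> (\<forall>w. 0 < w \<and> w < 1 \<longrightarrow> g w \<notin> d) \<or>
       (\<exists>u. passes d g u \<and> (u = s \<or> u = t \<or> side d (g s) = side d (g t)))"
  shows "free_edge A e (g s) (g t)"
proof (rule free_edge_subpath[OF g st])
  fix w d assume w: "min s t < w" "w < max s t" and d: "d \<in> A" "d \<noteq> e"
  have w01: "0 < w" "w < 1" using w st by auto
  \<comment> \<open>A crossing strictly between \<open>s\<close> and \<open>t\<close> would put the
    two ends on different sides of \<open>d\<close>.\<close>
  show "g w \<notin> d"
  proof
    assume gw: "g w \<in> d"
    then obtain u where u: "passes d g u" "u = s \<or> u = t \<or> side d (g s) = side d (g t)"
      using free[OF d] w01 by blast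
    have "w = u" using u(1) gw w01 unfolding passes_def by auto
    then have "side d (g s) = side d (g t)" using u(2) w by auto
    moreover have "side d (g (max s t)) = - side d (g (min s t))"
      by (rule side_passes(1)[OF d(1) u(1)]) (use w \<open>w = u\<close> st in auto)
    moreover have "side d (g (max s t)) = side d (g (min s t))"
      using calculation(1) by (simp add: max_def min_def)
    ultimately show False using side_values[of d "g (min s t)"] by linarith
  qed
qed

lemma inner_triangle:
  assumes abc: "a \<in> A" "b \<in> A" "c \<in> A" "distinct [a, b, c, C]"
    and same: "\<And>d. d \<in> A - {a, b, c, C} \<Longrightarrow>
      side d (h b (tau b c)) = side d (h a (tau a c)) \<and> side d (h a (tau a c)) = side d (h a (tau a b))"
  shows "\<exists>F\<in>triangles A. closure F \<inter> crossings A = {h b (tau b c), h a (tau a c), h a (tau a b)}"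
proof (rule triangle_from_free_edges[OF simple intersecting abc(1-3)])
  have edge: "free_edge A x (h x (tau x y)) (h x (tau x z))"
    if x: "x \<in> A" "y \<in> A" "z \<in> A" "distinct [x, y, z, C]"
      and sm: "\<And>d. d \<in> A - {x, y, z, C} \<Longrightarrow> side d (h x (tau x y)) = side d (h x (tau x z))" for x y z
  proof (rule arc_free_edge[OF arc_h(1)[OF x(1)] arc_h(2)[OF x(1)]])
    have "y \<noteq> x" "z \<noteq> x" "distinct [x, y, z]" using x(4) by (simp_all; metis)+
    then show "tau x y \<in> {0..1}" "tau x z \<in> {0..1}" "tau x y \<noteq> tau x z"
      using tau_range'[OF x(1,2)] tau_range'[OF x(1,3)] tau_inj[OF x(1-3)] by simp_all
    fix d assume d: "d \<in> A" "d \<noteq> x"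
    show "(\<forall>w. 0 < w \<and> w < 1 \<longrightarrow> h x w \<notin> d) \<or> (\<exists>u. passes d (h x) u \<and>
       (u = tau x y \<or> u = tau x z \<or> side d (h x (tau x y)) = side d (h x (tau x z))))"
    proof (cases "d = C")
      case True
      then show ?thesis using h_first_interior[OF x(1)] x(4) unfolding first_def by auto
    next
      case False
      then have "passes d (h x) (tau x d)" using passes_tau[of x d] x d unfolding first_def by auto
      then show ?thesis using sm[of d] d False by blast
    qed
  qed
  have sym: "h a (tau a b) = h b (tau b a)" "h a (tau a c) = h c (tau c a)" "h b (tau b c) = h c (tau c b)"
    using vertex_sym abc by auto
  show "free_edge A a (h a (tau a c)) (h a (tau a b))"
    by (rule edge) (use abc same in auto)
  show "free_edge A b (h a (tau a b)) (h b (tau b c))"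
    unfolding sym(1) by (rule edge) (use abc same sym in auto)
  show "free_edge A c (h b (tau b c)) (h a (tau a c))"
    unfolding sym(2,3) by (rule edge) (use abc same sym in auto)
  have ne: "b \<noteq> a" "c \<noteq> a" "c \<noteq> b" using abc(4) by (metis distinct_length_2_or_more)+
  show "h b (tau b c) \<in> b" "h b (tau b c) \<in> c" using h_tau[OF abc(2,3) ne(3)] .
  show "h a (tau a c) \<in> a" "h a (tau a c) \<in> c" using h_tau[OF abc(1,3) ne(2)] .
  show "h a (tau a b) \<in> a" "h a (tau a b) \<in> b" using h_tau[OF abc(1,2) ne(1)] .
  show "distinct [a, b, c]" using abc(4) by simp
qed

text \<open>The edge on \<open>C\<close> requires \<open>x\<close> and \<open>y\<close> to lie on a
  common one of the arcs \<open>h C\<close> and \<open>g'\<close>. If \<open>r\<close> is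
  \<open>a\<close> or \<open>b\<close>, one of the two points is an end of both arcs; otherwise
  \<open>x\<close> and \<open>y\<close> are on the same side of \<open>r\<close>, hence on the same
  arc.\<close>

lemma outer_triangle:
  assumes ab: "a \<in> A" "b \<in> A" "distinct [a, b, C]" and x: "x \<in> a \<inter> C" and y: "y \<in> b \<inter> C"
    and same: "\<And>d. d \<in> A - {a, b, C} \<Longrightarrow>
      side d x = side d (h a (tau a b)) \<and> side d y = side d (h a (tau a b))"
  shows "\<exists>F\<in>triangles A. closure F \<inter> crossings A = {y, x, h a (tau a b)}"
proof (rule triangle_from_free_edges[OF simple intersecting ab(1,2) C_in])
  have edge: "free_edge A p z (h p (tau p q))"
    if p: "p \<in> A" "q \<in> A" "distinct [p, q, C]" "z \<in> p \<inter> C"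
      and sm: "\<And>d. d \<in> A - {p, q, C} \<Longrightarrow> side d z = side d (h p (tau p q))" for p q z
  proof -
    obtain s where s: "s = 0 \<or> s = 1" "z = h p s" using chord_ends[of p] p by auto
    have t: "0 < tau p q \<and> tau p q < 1" using tau_range[of p q] p unfolding first_def by auto
    show ?thesis unfolding s(2)
    proof (rule arc_free_edge[OF arc_h(1)[OF p(1)] arc_h(2)[OF p(1)]])
      show "s \<in> {0..1}" "tau p q \<in> {0..1}" "s \<noteq> tau p q" using s t by auto
      fix d assume d: "d \<in> A" "d \<noteq> p"
      show "(\<forall>w. 0 < w \<and> w < 1 \<longrightarrow> h p w \<notin> d) \<or> (\<exists>u. passes d (h p) u \<and>
         (u = s \<or> u = tau p q \<or> side d (h p s) = side d (h p (tau p q))))"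
      proof (cases "d = C")
        case True
        then show ?thesis using h_first_interior[OF p(1)] p(3) unfolding first_def by auto
      next
        case False
        then have "passes d (h p) (tau p d)" using passes_tau[of p d] p d unfolding first_def by auto
        then show ?thesis using sm[of d] s d False by blast
      qed
    qed
  qed
  have sym: "h a (tau a b) = h b (tau b a)" using vertex_sym ab by auto
  show "free_edge A a x (h a (tau a b))"
    by (rule edge) (use ab x same in auto)
  show "free_edge A b (h a (tau a b)) y"
    by (rule free_edge_sym, unfold sym, rule edge) (use ab y same sym in auto)
  show "free_edge A C y x"
  proof -
    have xy: "x \<noteq> y" using sa(3)[OF ab(1,2) C_in ab(3), of x] x y by auto
    have arc_C: "free_edge A C y x"
      if g: "arc g" "path_image g \<subseteq> C" "y \<in> path_image g" "x \<in> path_image g"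
        and r_free: "\<And>w. 0 < w \<Longrightarrow> w < 1 \<Longrightarrow> g w \<notin> r"
        and ps: "\<And>d. d \<in> A \<Longrightarrow> d \<noteq> C \<Longrightarrow> d \<noteq> r \<Longrightarrow> \<exists>t. passes d g t" for g
    proof -
      obtain s t where st: "s \<in> {0..1}" "t \<in> {0..1}" "y = g s" "x = g t"
        using g(3,4) unfolding path_image_def by blast
      show ?thesis unfolding st(3,4)
      proof (rule arc_free_edge[OF g(1,2) st(1,2)])
        show "s \<noteq> t" using st xy by blast
        fix d assume d: "d \<in> A" "d \<noteq> C"
        show "(\<forall>w. 0 < w \<and> w < 1 \<longrightarrow> g w \<notin> d) \<or> (\<exists>u. passes d g u \<and>
         (u = s \<or> u = t \<or> side d (g s) = side d (g t)))"
        proof (cases "d = r")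
          case True then show ?thesis using r_free by blast
        next
          case False
          then obtain u where u: "passes d g u" using ps d by blast
          have "u = s \<or> u = t \<or> side d (g s) = side d (g t)"
          proof (cases "d = a \<or> d = b")
            case True
            then have "g t \<in> d \<or> g s \<in> d" using x y st by auto
            moreover have "g w \<in> d \<longleftrightarrow> w = u" if "w \<in> {0..1}" for w
              using u that unfolding passes_def by blast
            ultimately show ?thesis using st(1,2) by blast
          next
            case False
            then show ?thesis using same[of d] d st by auto
          qed
          then show ?thesis using u by blast
        qed
      qed
    qed
    have "(x \<in> path_image (h C) \<and> y \<in> path_image (h C)) \<or> (x \<in> path_image g' \<and> y \<in> path_image g')"
    proof -
      have dich: "(z \<in> path_image (h C) \<and> z \<in> path_image g') \<or>
          (z \<in> path_image (h C) \<and> z \<in> K \<and> z \<notin> r) \<or> (z \<in> path_image g' \<and> z \<in> K' \<and> z \<notin> r)" if "z \<in> C" for z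
      proof -
        have ends: "h C 0 \<in> path_image (h C)" "h C 1 \<in> path_image (h C)" "h C 0 \<in> path_image g'" "h C 1 \<in> path_image g'"
          using g'(3,4) unfolding path_image_def by (metis atLeastAtMost_iff image_eqI order_refl zero_le_one)+
        have Kr: "K \<inter> r = {}" "K' \<inter> r = {}" using in_components_subset K(1,2) by blast+
        consider s where "s \<in> {0..1}" "z = h C s" | s where "s \<in> {0..1}" "z = g' s"
          using \<open>z \<in> C\<close> g'(2) unfolding path_image_def by blast
        then show ?thesis
        proof cases
          case (1 s)
          show ?thesis
          proof (cases "s = 0 \<or> s = 1")
            case True then show ?thesis using ends 1 by auto
          next
            case False
            then have "z \<in> K" using C_interior(1)[of s] 1 by auto
            then show ?thesis using 1 Kr unfolding path_image_def by blast
          qed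
        next
          case (2 s)
          show ?thesis
          proof (cases "s = 0 \<or> s = 1")
            case True then show ?thesis using ends g'(3,4) 2 by auto
          next
            case False
            then have "z \<in> K'" using C_interior(2)[of s] 2 by auto
            then show ?thesis using 2 Kr unfolding path_image_def by blast
          qed
        qed
      qed
      show ?thesis
      proof (rule ccontr)
        assume n: "\<not> ?thesis"
        have mixed: "(x \<in> K \<and> y \<in> K' \<or> x \<in> K' \<and> y \<in> K) \<and> x \<notin> r \<and> y \<notin> r"
          using dich[of x] dich[of y] x y n by blast
        then have "r \<noteq> a" "r \<noteq> b" using x y by blast+
        then have "side r x = side r y" using same[of r] r by auto
        moreover have "side r x = - side r y"
          using mixed side_opposite[OF r(1) K, of x y] side_opposite[OF r(1) K, of y x] by auto
        ultimately show False using side_values[of r y] by auto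
      qed
    qed
    then show ?thesis
    proof
      assume "x \<in> path_image (h C) \<and> y \<in> path_image (h C)"
      then show ?thesis
        using arc_C[of "h C"] arc_h[OF C_in] h_first_interior[OF C_in] passes_tau[OF C_in] unfolding first_def by auto
    next
      assume "x \<in> path_image g' \<and> y \<in> path_image g'"
      moreover have "g' w \<notin> r" if "0 < w" "w < 1" for w
        using C_interior(2)[OF that] in_components_subset[OF K(2)] by blast
      ultimately show ?thesis using arc_C[of g'] g'(1,2) passes_g' by blast
    qed
  qed
  have ne: "b \<noteq> a" using ab(3) by (metis distinct_length_2_or_more)
  show "h a (tau a b) \<in> a" "h a (tau a b) \<in> b" using h_tau[OF ab(1,2) ne] .
  show "x \<in> a" "x \<in> C" "y \<in> b" "y \<in> C" using x y by blast+
qed (rule ab(3))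

end

section \<open>Counting triangles on both sides\<close>

context side_charts
begin

text \<open>Cells are recorded by their vertex sets. Distinct sets come from distinct cells, so a
  lower bound for the number of sets suffices, and a vertex in \<open>U\<close> tells the two sides
  of \<open>C\<close> apart.\<close>

definition side_triangles :: "(real^3) set set" where
  "side_triangles = {T. \<exists>F\<in>triangles A. T = closure F \<inter> crossings A \<and> T \<subseteq> U \<union> C \<and> T \<inter> U \<noteq> {}}"

lemma incident_curves:
  assumes "a \<in> A" "b \<in> A" "c \<in> A" "distinct [a, b, c]" "p \<in> b \<inter> c" "q \<in> a \<inter> c" "v \<in> a \<inter> b"
  shows "{e \<in> A. e \<inter> {p, q, v} \<noteq> {}} = {a, b, c}"
proof -
  have "e \<in> {a, b, c}" if e: "e \<in> A" "e \<inter> {p, q, v} \<noteq> {}" for e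
  proof (rule ccontr)
    assume "e \<notin> {a, b, c}"
    then have "distinct [b, c, e]" "distinct [a, c, e]" "distinct [a, b, e]" using assms(4) by auto
    then have "p \<notin> e" "q \<notin> e" "v \<notin> e"
      using sa(3)[OF assms(2,3) e(1)] sa(3)[OF assms(1,3) e(1)] sa(3)[OF assms(1,2) e(1)] assms(5-7) by blast+
    then show False using e(2) by blast
  qed
  then show ?thesis using assms(1-3,5-7) by blast
qed

lemma vertex_in_U:
  assumes "a \<in> A" "b \<in> A" "a \<noteq> C" "b \<noteq> C" "b \<noteq> a"
  shows "h a (tau a b) \<in> U"
  using chord_interior[OF assms(1,3)] tau_range[OF assms(1,2,5)] assms(3,4) unfolding first_def by simp

text \<open>Each other curve \<open>d\<close> is compared with \<open>C\<close>. All three vertices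
  lie in \<open>U\<close>, where \<open>C\<close> has constant sign, so emptiness forces
  \<open>d\<close> to have constant sign at them as well.\<close>

lemma empty_triangle_inner:
  assumes abc: "a \<in> A" "b \<in> A" "c \<in> A" "distinct [a, b, c, C]" and empty: "empty_triangle a b c"
  shows "\<exists>T\<in>side_triangles. {e \<in> A. e \<inter> T \<noteq> {}} = {a, b, c}"
proof -
  define p q v where "p = h b (tau b c)" and "q = h a (tau a c)" and "v = h a (tau a b)"
  have ne: "b \<noteq> a" "c \<noteq> a" "c \<noteq> b" "a \<noteq> c" "a \<noteq> b" "b \<noteq> c" "a \<noteq> C" "b \<noteq> C" "c \<noteq> C"
    using abc(4) by (metis distinct_length_2_or_more)+
  have in_U: "p \<in> U" "q \<in> U" "v \<in> U"
    unfolding p_def q_def v_def using vertex_in_U abc ne by simp_all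
  have sC: "side C z = 1" if "z \<in> U" for z using that unfolding side_def pos_def by simp
  have chi: "chi b c d = start_side b c * side d p" "chi c a d = start_side c a * side d q"
    "chi a b d = start_side a b * side d v" for d
    using vertex_sym[OF abc(3,1) ne(2)] unfolding chi_def p_def q_def v_def by simp_all
  have eqs: "side d p = side d q \<and> side d q = side d v" if d: "d \<in> A - {a, b, c, C}" for d
  proof -
    have "d \<in> A - {a, b, c}" "C \<in> A - {a, b, c}" using d C_in ne by blast+
    then have "chi b c d * chi c a d = chi b c C * chi c a C" "chi c a d * chi a b d = chi c a C * chi a b C"
      using empty unfolding empty_triangle_def by blast+
    then show ?thesis unfolding chi sC[OF in_U(1)] sC[OF in_U(2)] sC[OF in_U(3)]
      using start_side_values[of b c] start_side_values[of c a] start_side_values[of a b]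
        side_values[of d p] side_values[of d q] side_values[of d v]
      by (elim disjE) simp_all
  qed
  obtain F where F: "F \<in> triangles A" "closure F \<inter> crossings A = {p, q, v}"
    using inner_triangle[OF abc] eqs unfolding p_def q_def v_def by blast
  have "{p, q, v} \<in> side_triangles" unfolding side_triangles_def using F in_U by auto
  moreover have "{e \<in> A. e \<inter> {p, q, v} \<noteq> {}} = {a, b, c}"
    by (rule incident_curves[OF abc(1-3)])
      (use abc(4) h_tau[OF abc(2,3) ne(3)] h_tau[OF abc(1,3) ne(2)] h_tau[OF abc(1,2) ne(1)] in
        \<open>simp_all add: p_def q_def v_def\<close>)
  ultimately show ?thesis by blast
qed

lemma outer_side_triangle:
  assumes ab: "a \<in> A" "b \<in> A" "distinct [a, b, C]" and x: "x \<in> a \<inter> C" and y: "y \<in> b \<inter> C"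
    and same: "\<And>d. d \<in> A - {a, b, C} \<Longrightarrow>
      side d x = side d (h a (tau a b)) \<and> side d y = side d (h a (tau a b))"
  shows "{y, x, h a (tau a b)} \<in> side_triangles" "{e \<in> A. e \<inter> {y, x, h a (tau a b)} \<noteq> {}} = {a, b, C}"
proof -
  have ne: "b \<noteq> a" "a \<noteq> C" "b \<noteq> C" using ab(3) by (metis distinct_length_2_or_more)+
  obtain F where "F \<in> triangles A" "closure F \<inter> crossings A = {y, x, h a (tau a b)}"
    using outer_triangle[OF ab x y same] by blast
  then show "{y, x, h a (tau a b)} \<in> side_triangles"
    unfolding side_triangles_def using vertex_in_U[OF ab(1,2) ne(2,3,1)] x y by auto
  show "{e \<in> A. e \<inter> {y, x, h a (tau a b)} \<noteq> {}} = {a, b, C}"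
    using incident_curves[OF ab(1,2) C_in ab(3) y x] h_tau[OF ab(1,2) ne(1)] by blast
qed

text \<open>At \<open>C\<close> each of the chords \<open>a\<close> and \<open>b\<close> offers two
  ends, and passing to the other end flips the sign of every further curve. One such curve
  \<open>d0\<close> selects the ends that lie on its side of \<open>v\<close>, and emptiness carries
  the choice over to all others.\<close>

lemma empty_triangle_outer:
  assumes ab: "a \<in> A" "b \<in> A" "distinct [a, b, C]" and empty: "empty_triangle a b C" and card4: "card A \<ge> 4"
  shows "\<exists>T\<in>side_triangles. {e \<in> A. e \<inter> T \<noteq> {}} = {a, b, C}"
proof -
  have ne: "b \<noteq> a" "a \<noteq> b" "a \<noteq> C" "b \<noteq> C" "C \<noteq> a" "C \<noteq> b" using ab(3) by (metis distinct_length_2_or_more)+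
  define v where "v = h a (tau a b)"
  have chi: "chi b C d = - side d (h b 0)" "chi C a d = side d (h a 0)" "chi a b d = start_side a b * side d v" for d
    using start_side_C[OF ab(1) ne(3)] start_side_C[OF ab(2) ne(4)] tau_0(2)[OF ab(2) ne(4)]
      chord_start[OF ab(1) ne(3)] unfolding chi_def v_def by simp_all
  have "card {a, b, C} \<le> 3" by (simp add: card_insert_if)
  then have "\<not> A \<subseteq> {a, b, C}" using card4 card_mono[of "{a, b, C}" A] by auto
  then obtain d0 where d0: "d0 \<in> A - {a, b, C}" by blast
  have prods: "side d (h b 0) * side d (h a 0) = side d0 (h b 0) * side d0 (h a 0)"
    "side d (h a 0) * side d v = side d0 (h a 0) * side d0 v" if d: "d \<in> A - {a, b, C}" for d
  proof -
    have "chi b C d * chi C a d = chi b C d0 * chi C a d0" "chi C a d * chi a b d = chi C a d0 * chi a b d0"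
      using empty d d0 unfolding empty_triangle_def by blast+
    then show "side d (h b 0) * side d (h a 0) = side d0 (h b 0) * side d0 (h a 0)"
      "side d (h a 0) * side d v = side d0 (h a 0) * side d0 v"
      unfolding chi using start_side_values[of a b] by auto
  qed
  have flip: "side d (h x 1) = - side d (h x 0)" if "x \<in> {a, b}" "d \<in> A - {a, b, C}" for x d
  proof -
    have x: "x \<in> A" "d \<in> A" "d \<noteq> x" "d \<noteq> first x" using that ab ne unfolding first_def by auto
    show ?thesis using side_passes(1)[OF x(2) passes_tau[OF x], of 0 1] tau_range[OF x] by simp
  qed
  define x where "x = h a (if side d0 (h a 0) = side d0 v then 0 else 1)"
  define y where "y = h b (if side d0 (h b 0) = side d0 v then 0 else 1)"
  have xy: "x \<in> a \<inter> C" "y \<in> b \<inter> C"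
    using chord_ends[OF ab(1) ne(3)] chord_ends[OF ab(2) ne(4)] unfolding x_def y_def by auto
  have same: "side d x = side d v \<and> side d y = side d v" if d: "d \<in> A - {a, b, C}" for d
    using prods[OF d] flip[OF _ d, of a] flip[OF _ d, of b] flip[OF _ d0, of a] flip[OF _ d0, of b]
      side_values[of d "h a 0"] side_values[of d "h b 0"] side_values[of d v]
      side_values[of d0 "h a 0"] side_values[of d0 "h b 0"] side_values[of d0 v]
    unfolding x_def y_def by (elim disjE) simp_all
  show ?thesis using outer_side_triangle[OF ab xy] same unfolding v_def by blast
qed

text \<open>From four curves on, the curves through a vertex set give a surjection onto the empty
  triangles of the chirotope. With three curves there is just one triple of curves, but no further
  curve can interfere: every choice of an end of each chord gives a triangle with \<open>v\<close>,
  and three of the four choices are listed.\<close>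

lemma card_side_triangles:
  assumes fin: "finite (triangles A)"
  shows "card A \<le> card side_triangles"
proof -
  have "side_triangles \<subseteq> (\<lambda>F. closure F \<inter> crossings A) ` triangles A" unfolding side_triangles_def by blast
  then have fin': "finite side_triangles" using fin finite_surj by blast
  show ?thesis
  proof (cases "card A \<ge> 4")
    case True
    have "empty_triangles \<subseteq> (\<lambda>T. {e \<in> A. e \<inter> T \<noteq> {}}) ` side_triangles"
    proof
      fix S assume "S \<in> empty_triangles"
      then obtain a b c where abc: "a \<in> A" "b \<in> A" "c \<in> A" "distinct [a, b, c]" "S = {a, b, c}" "empty_triangle a b c"
        unfolding empty_triangles_def by blast
      have rot: "distinct [b, c, a]" "distinct [c, a, b]" using abc(4) by (metis distinct_length_2_or_more distinct_singleton)+
      have e2: "empty_triangle b c a" using empty_triangle_rotate[OF abc(6,1-4)] .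
      have e3: "empty_triangle c a b" using empty_triangle_rotate[OF e2 abc(2,3,1) rot(1)] .
      consider "a = C" | "b = C" | "c = C" | "C \<notin> {a, b, c}" by blast
      then have "\<exists>T\<in>side_triangles. {e \<in> A. e \<inter> T \<noteq> {}} = S"
      proof cases
        case 1
        have "\<exists>T\<in>side_triangles. {e \<in> A. e \<inter> T \<noteq> {}} = {b, c, C}"
          by (rule empty_triangle_outer[OF abc(2,3) _ _ True]) (use rot(1) e2 1 in simp_all)
        moreover have "{b, c, C} = S" using 1 abc(5) by blast
        ultimately show ?thesis by simp
      next
        case 2
        have "\<exists>T\<in>side_triangles. {e \<in> A. e \<inter> T \<noteq> {}} = {c, a, C}"
          by (rule empty_triangle_outer[OF abc(3,1) _ _ True]) (use rot(2) e3 2 in simp_all)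
        moreover have "{c, a, C} = S" using 2 abc(5) by blast
        ultimately show ?thesis by simp
      next
        case 3
        have "\<exists>T\<in>side_triangles. {e \<in> A. e \<inter> T \<noteq> {}} = {a, b, C}"
          by (rule empty_triangle_outer[OF abc(1,2) _ _ True]) (use abc(4,6) 3 in simp_all)
        then show ?thesis unfolding abc(5) 3 .
      next
        case 4
        then have "a \<noteq> C" "b \<noteq> C" "c \<noteq> C" by blast+
        then have "distinct [a, b, c, C]" using abc(4) by simp
        then show ?thesis unfolding abc(5) by (rule empty_triangle_inner[OF abc(1-3) _ abc(6)])
      qed
      then show "S \<in> (\<lambda>T. {e \<in> A. e \<inter> T \<noteq> {}}) ` side_triangles" by blast
    qed
    then have "card empty_triangles \<le> card side_triangles"
      using surj_card_le[OF fin'] by blast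
    then show ?thesis using card_empty_triangles[OF True] by linarith
  next
    case False
    then have card3: "card A = 3" using card_ge_3 by linarith
    have "card (A - {C}) = 2" using card3 C_in sa(1) by simp
    then obtain a b where ab0: "A - {C} = {a, b}" "a \<noteq> b" by (meson card_2_iff)
    then have ab: "a \<in> A" "b \<in> A" "a \<noteq> C" "b \<noteq> C" by blast+
    have A: "A - {a, b, C} = {}" using ab0 by blast
    have d: "distinct [a, b, C]" using ab ab0 by simp
    define v where "v = h a (tau a b)"
    have mem: "{y, x, v} \<in> side_triangles" if "x \<in> a \<inter> C" "y \<in> b \<inter> C" for x y
      using outer_side_triangle(1)[OF ab(1,2) d that] A unfolding v_def by blast
    obtain x x' where x: "a \<inter> C = {x, x'}" "x \<noteq> x'" using crossing_points[OF ab(1) C_in ab(3)] .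
    obtain y y' where y: "b \<inter> C = {y, y'}" "y \<noteq> y'" using crossing_points[OF ab(2) C_in ab(4)] .
    have "v \<in> U" unfolding v_def using vertex_in_U[OF ab(1,2)] ab ab0 by blast
    then have "v \<notin> C" using in_components_subset[OF U] by blast
    then have nv: "v \<noteq> x" "v \<noteq> x'" "v \<noteq> y" "v \<noteq> y'" using x y by blast+
    have "a \<inter> b \<inter> C = {}" using sa(3)[OF ab(1,2) C_in d] by blast
    then have nxy: "x \<noteq> y" "x \<noteq> y'" "x' \<noteq> y" "x' \<noteq> y'" using x y by blast+
    have "{{y, x, v}, {y', x, v}, {y, x', v}} \<subseteq> side_triangles" using mem x y by blast
    moreover have "{y, x, v} \<noteq> {y', x, v}" "{y, x, v} \<noteq> {y, x', v}" "{y', x, v} \<noteq> {y, x', v}"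
      using nv nxy x(2) y(2) by blast+
    then have "card {{y, x, v}, {y', x, v}, {y, x', v}} = 3" by simp
    ultimately show ?thesis using card3 card_mono[OF fin'] by metis
  qed
qed

end

context separated_arrangement
begin

text \<open>Any curve other than \<open>C\<close> can serve as \<open>r\<close>. The chords are
  oriented to start at their crossing with the chosen arc \<open>g\<close> of \<open>C\<close>, as
  \<open>chord_start\<close> demands.\<close>

lemma triangles_on_side:
  assumes U: "U \<in> components (S2 - C)" and fin: "finite (triangles A)"
  shows "card A \<le> card {T. \<exists>F\<in>triangles A. T = closure F \<inter> crossings A \<and> T \<subseteq> U \<union> C \<and> T \<inter> U \<noteq> {}}"
proof -
  have "\<not> A \<subseteq> {C}" using card_ge_3 card_mono[of "{C}" A] by auto
  then obtain r where r: "r \<in> A" "r \<noteq> C" by blast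
  obtain g g' K K' where g: "arc g" "arc g'" "path_image g \<union> path_image g' = C" "g' 0 = g 0" "g' 1 = g 1"
    "C \<inter> r = {g 0, g 1}" "K \<in> components (S2 - r)" "K' \<in> components (S2 - r)" "K \<noteq> K'"
    "\<And>s. 0 < s \<Longrightarrow> s < 1 \<Longrightarrow> g s \<in> K" "\<And>s. 0 < s \<Longrightarrow> s < 1 \<Longrightarrow> g' s \<in> K'"
    "\<And>d. d \<in> A \<Longrightarrow> d \<noteq> C \<Longrightarrow> d \<noteq> r \<Longrightarrow> \<exists>t. passes d g t"
    "\<And>d. d \<in> A \<Longrightarrow> d \<noteq> C \<Longrightarrow> d \<noteq> r \<Longrightarrow> \<exists>t. passes d g' t"
  proof (rule C_halves[OF r], goal_cases)
    case (1 g g' K K')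
    show ?case by (rule that) (fact 1)+
  qed
  define u where "u d = (if d = r then 0 else SOME t. passes d g t)" for d
  have u: "passes d g (u d)" if "d \<in> A" "d \<noteq> C" "d \<noteq> r" for d
    unfolding u_def if_not_P[OF that(3)] by (rule someI_ex[OF g(12)[OF that]])
  have gu: "g (u a) \<in> a" "g (u a) \<in> C" if a: "a \<in> A" "a \<noteq> C" for a
  proof -
    show "g (u a) \<in> a"
    proof (cases "a = r")
      case True then show ?thesis using g(6) unfolding u_def by auto
    next
      case False
      then show ?thesis using u[OF a] unfolding passes_def by auto
    qed
    have "u a \<in> {0..1}"
      using u[OF a] unfolding passes_def by (cases "a = r") (auto simp: u_def)
    then show "g (u a) \<in> C" using g(3) unfolding path_image_def by blast
  qed
  have "\<exists>k. arc k \<and> path_image k \<subseteq> a \<and> k 0 = g (u a) \<and> a \<inter> C = {k 0, k 1} \<and>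
    (\<forall>s. 0 < s \<and> s < 1 \<longrightarrow> k s \<in> U) \<and> (\<forall>d\<in>A. d \<noteq> C \<and> d \<noteq> a \<longrightarrow> (\<exists>t. passes d k t))"
    if a: "a \<in> A - {C}" for a
  proof -
    have a': "a \<in> A" "a \<noteq> C" using a by auto
    obtain k where "arc k" "path_image k \<subseteq> a" "k 0 = g (u a)" "a \<inter> C = {k 0, k 1}"
      "\<And>s. 0 < s \<Longrightarrow> s < 1 \<Longrightarrow> k s \<in> U"
      "\<And>d. d \<in> A \<Longrightarrow> d \<noteq> C \<Longrightarrow> d \<noteq> a \<Longrightarrow> \<exists>t. passes d k t"
      using chord[OF a' gu[OF a'] U] by metis
    then show ?thesis by blast
  qed
  then obtain k where k: "\<And>a. a \<in> A - {C} \<Longrightarrow> arc (k a) \<and> path_image (k a) \<subseteq> a \<and> k a 0 = g (u a) \<and> a \<inter> C = {k a 0, k a 1} \<and>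
    (\<forall>s. 0 < s \<and> s < 1 \<longrightarrow> k a s \<in> U) \<and> (\<forall>d\<in>A. d \<noteq> C \<and> d \<noteq> a \<longrightarrow> (\<exists>t. passes d (k a) t))"
    by metis
  define h where "h e = (if e = C then g else k e)" for e
  define tau where "tau e d = (if e = C then u d else if d = C then 0 else SOME t. passes d (k e) t)" for e d
  interpret side_charts A C U r h tau g' K K'
  proof
    show "U \<in> components (S2 - C)" "r \<in> A" "r \<noteq> C" by fact+
    show "arc (h e)" "path_image (h e) \<subseteq> e" if "e \<in> A" for e
      using k[of e] g(1,3) that unfolding h_def by auto
    show "arc g'" "path_image (h C) \<union> path_image g' = C" "g' 0 = h C 0" "g' 1 = h C 1" "C \<inter> r = {h C 0, h C 1}"
      using g(2-6) unfolding h_def by simp_all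
    show "K \<in> components (S2 - r)" "K' \<in> components (S2 - r)" "K \<noteq> K'" by fact+
    show "h C s \<in> K" "g' s \<in> K'" if "0 < s" "s < 1" for s using g(10,11)[OF that] unfolding h_def by simp_all
    show "h a 0 = h C (tau C a)" "a \<inter> C = {h a 0, h a 1}" if "a \<in> A" "a \<noteq> C" for a
      using k[of a] that unfolding h_def tau_def by auto
    show "h a s \<in> U" if "a \<in> A" "a \<noteq> C" "0 < s" "s < 1" for a s
      using k[of a] that unfolding h_def by auto
    show "tau C r = 0" unfolding tau_def u_def by simp
    show "tau a C = 0" if "a \<in> A" "a \<noteq> C" for a using that unfolding tau_def by simp
    show "passes d (h e) (tau e d)" if e: "e \<in> A" "d \<in> A" "d \<noteq> e" "d \<noteq> (if e = C then r else C)" for e d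
    proof (cases "e = C")
      case True
      then show ?thesis using u[of d] e unfolding h_def tau_def by simp
    next
      case False
      then have "\<exists>t. passes d (k e) t" using k[of e] e by simp
      then have "passes d (k e) (SOME t. passes d (k e) t)" by (rule someI_ex)
      then show ?thesis using False e unfolding h_def tau_def by simp
    qed
    show "\<exists>t. passes d g' t" if "d \<in> A" "d \<noteq> C" "d \<noteq> r" for d using g(13)[OF that] .
  qed
  show ?thesis using card_side_triangles[OF fin] unfolding side_triangles_def .
qed

section \<open>Finiteness of the set of cells and the total count\<close>

lemma infinite_pseudocircle: "a \<in> A \<Longrightarrow> infinite a"
proof
  assume a: "a \<in> A" "finite a"
  obtain d where "d \<in> A" "d \<noteq> a"
  proof -
    have "\<not> A \<subseteq> {a}" using card_ge_3 card_mono[of "{a}" A] by auto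
    then show ?thesis using that by blast
  qed
  then obtain x y where "a \<inter> d = {x, y}" "x \<noteq> y" using crossing_points[OF a(1)] by metis
  then show False using connected_finite_iff_sing[OF connected_pseudocircle[OF sa(2)[OF a(1)]]] a(2) by auto
qed

text \<open>To add a curve \<open>a\<close>, Janiszewski's theorem is applied to the union of the curves already present and
  the closed side of \<open>a\<close> that avoids \<open>x\<close> and \<open>y\<close>. Their intersection is connected: it consists of one
  arc of each curve, and all of these arcs meet the one of \<open>C\<close>.\<close>

lemma same_cell:
  assumes "L \<subseteq> A - {C}"
    and "\<And>d. d \<in> insert C L \<Longrightarrow> connected_component (S2 - d) x y"
  shows "connected_component (S2 - \<Union>(insert C L)) x y"
proof -
  have "finite L" using assms(1) sa(1) finite_subset by blast
  then show ?thesis using assms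
  proof (induction L rule: finite_induct)
    case empty
    then show ?case by simp
  next
    case (insert a L)
    define A' where "A' = insert C L"
    define S where "S = \<Union>A'"
    have A': "A' \<subseteq> A" "a \<in> A" "a \<notin> A'" "finite A'"
      using insert.prems(1) insert.hyps C_in unfolding A'_def by auto
    have aC: "a \<noteq> C" using insert.prems(1) by blast
    have cS: "connected_component (S2 - S) x y"
      unfolding S_def A'_def using insert.IH insert.prems by blast
    have ca: "connected_component (S2 - a) x y" using insert.prems(2) by blast
    obtain P Q where PQ: "P \<noteq> Q" "components (S2 - a) = {P, Q}" "closure P = P \<union> a" "closure Q = Q \<union> a"
      using two_components[OF A'(2)] by metis
    obtain Z where Z: "Z \<in> components (S2 - a)" "x \<in> Z" "y \<in> Z"
      using ca connected_component_in[OF ca] unfolding components_def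
      by (metis (mono_tags, lifting) connected_component_refl_eq image_eqI mem_Collect_eq)
    obtain Y where Y: "components (S2 - a) = {Z, Y}" "Y \<noteq> Z" "closure Y = Y \<union> a"
      using PQ Z(1) by (metis doubleton_eq_iff insertE singletonD)
    have YZ: "Y \<inter> Z = {}" using components_nonoverlap[of Y "S2 - a" Z] Y by simp
    have cover: "Y \<union> Z = S2 - a" using Union_components[of "S2 - a"] unfolding Y(1) by (simp add: Un_commute)
    define T where "T = Y \<union> a"
    have aS: "a \<subseteq> S2" using pseudocircle_subset sa(2) A' by blast
    have T: "closed T" "T \<subseteq> S2" "S2 - T = Z"
      using Y(3) closed_closure[of Y] aS cover YZ unfolding T_def by auto
    have S: "closed S" "S \<subseteq> S2"
      unfolding S_def using A'(1,4) closed_pseudocircle pseudocircle_subset sa(2) by blast+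
    \<comment> \<open>\<open>a\<close> splits \<open>d\<close> into two arcs on different sides of
      \<open>a\<close>. One of them is contained in \<open>T\<close>, and the other meets
      \<open>T\<close> only at its ends.\<close>
    have part: "connected (d \<inter> T)" if d: "d \<in> A'" for d
    proof -
      have dA: "d \<in> A" "d \<noteq> a" using d A' by blast+
      obtain z z' where z: "d \<inter> a = {z, z'}" "z \<noteq> z'" using crossing_points[OF dA(1) A'(2) dA(2)] .
      have cr: "crosses_at a d z" using crossing(2)[OF A'(2) dA(1) dA(2)[symmetric]] z by blast
      obtain u w M N where uw: "arc u" "arc w" "pathstart u = z" "pathfinish u = z'" "pathstart w = z" "pathfinish w = z'"
        "path_image u \<union> path_image w = d" "path_image u \<inter> path_image w = {z, z'}"
        "M \<in> components (S2 - a)" "N \<in> components (S2 - a)" "M \<noteq> N"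
        "path_image u - {z, z'} \<subseteq> M" "path_image w - {z, z'} \<subseteq> N"
        using crossing_halves[OF sa(2)[OF dA(1)] z cr] .
      have halves: "connected (path_image u)" "connected (path_image w)" using uw(1,2) connected_arc_image by blast+
      have ends: "z \<in> a" "z' \<in> a" "z \<in> path_image u" "z' \<in> path_image u" "z \<in> path_image w" "z' \<in> path_image w"
        using z(1) uw(8) by blast+
      have "d \<inter> T = path_image u \<or> d \<inter> T = path_image w"
      proof (cases "M = Y")
        case True
        moreover have "N \<in> {Z, Y}" using uw(10) unfolding Y(1) .
        ultimately have N: "N = Z" using uw(11) by blast
        have "path_image u \<subseteq> T" using uw(12) True ends unfolding T_def by blast
        moreover have "path_image w \<inter> T \<subseteq> {z, z'}"
          using uw(13) N T(3) by blast
        ultimately show ?thesis using uw(7) ends by blast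
      next
        case False
        moreover have "M \<in> {Z, Y}" "N \<in> {Z, Y}" using uw(9,10) unfolding Y(1) .
        ultimately have M: "M = Z" "N = Y" using uw(11) by blast+
        have "path_image w \<subseteq> T" using uw(13) M ends unfolding T_def by blast
        moreover have "path_image u \<inter> T \<subseteq> {z, z'}"
          using uw(12) M T(3) by blast
        ultimately show ?thesis using uw(7) ends by blast
      qed
      then show ?thesis using halves by auto
    qed
    \<comment> \<open>The two points of \<open>d\<close> on \<open>C\<close> are on different sides
      of \<open>a\<close>, so one of them lies in \<open>Y\<close>.\<close>
    have meet: "C \<inter> d \<inter> T \<noteq> {}" if d: "d \<in> A'" for d
    proof (cases "d = C")
      case True
      have "C \<inter> a \<noteq> {}" using intersecting C_in A'(2) aC unfolding pairwise_intersecting_def by metis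
      then show ?thesis using True unfolding T_def by blast
    next
      case False
      have dA: "d \<in> A" "d \<noteq> a" using d A' by blast+
      obtain z z' where z: "d \<inter> C = {z, z'}" "z \<noteq> z'" using crossing_points[OF dA(1) C_in False] .
      obtain M N where "M \<in> components (S2 - a)" "N \<in> components (S2 - a)" "M \<noteq> N" "z \<in> M" "z' \<in> N"
        using opposite_ends[OF dA(1) False A'(2) aC dA(2)[symmetric] z] .
      then have "z \<in> Y \<or> z' \<in> Y" using Y(1) by blast
      then show ?thesis using z unfolding T_def by blast
    qed
    have conn: "connected (S \<inter> T)"
    proof -
      have "S \<inter> T = \<Union> ((\<lambda>d. (C \<inter> T) \<union> (d \<inter> T)) ` A')" unfolding S_def A'_def by blast
      moreover have "connected (\<Union> ((\<lambda>d. (C \<inter> T) \<union> (d \<inter> T)) ` A'))"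
      proof (rule connected_Union)
        have C': "C \<in> A'" unfolding A'_def by simp
        fix X assume "X \<in> (\<lambda>d. (C \<inter> T) \<union> (d \<inter> T)) ` A'"
        then obtain d where d: "d \<in> A'" "X = (C \<inter> T) \<union> (d \<inter> T)" by blast
        have "(C \<inter> T) \<inter> (d \<inter> T) \<noteq> {}" using meet[OF d(1)] by blast
        then show "connected X" unfolding d(2) using connected_Un part[OF d(1)] part[OF C'] by blast
      next
        have "C \<inter> T \<noteq> {}" using meet[of C] unfolding A'_def by blast
        then show "\<Inter> ((\<lambda>d. (C \<inter> T) \<union> (d \<inter> T)) ` A') \<noteq> {}" by blast
      qed
      ultimately show ?thesis by simp
    qed
    \<comment> \<open>A point of \<open>a\<close> on none of the curves already present:
      \<open>a\<close> is infinite and meets each of them in finitely many points. It becomes the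
      chart centre in \<open>Janiszewski_sphere\<close>.\<close>
    obtain p where p: "p \<in> T - S"
    proof -
      have "finite (a \<inter> d)" if "d \<in> A'" for d
        using crossing(1)[of a d] that A' by (metis card.infinite subsetD zero_neq_numeral)
      then have "finite (\<Union>d\<in>A'. a \<inter> d)" using A'(4) by blast
      then have "infinite (a - (\<Union>d\<in>A'. a \<inter> d))" using infinite_pseudocircle[OF A'(2)] by simp
      then obtain p where "p \<in> a - (\<Union>d\<in>A'. a \<inter> d)" by (metis ex_in_conv finite.emptyI)
      then show ?thesis using that[of p] unfolding T_def S_def by blast
    qed
    have "S \<noteq> {}" using conn meet[of C] unfolding S_def A'_def by blast
    moreover have "connected_component (S2 - T) x y"
      unfolding T(3) connected_component_def using Z in_components_connected[OF Z(1)] by blast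
    ultimately have "connected_component (S2 - (S \<union> T)) x y"
      using Janiszewski_sphere[OF S _ T(1,2) p conn cS] by blast
    moreover have "S2 - (S \<union> T) \<subseteq> S2 - \<Union>(insert C (insert a L))"
      unfolding S_def T_def A'_def by blast
    ultimately show ?case using connected_component_of_subset by metis
  qed
qed

lemma finite_cells: "finite (cells A)"
proof -
  define D where "D = (\<Union>d\<in>A. components (S2 - d))"
  define sig where "sig F = {M \<in> D. F \<subseteq> M}" for F
  have finD: "finite D" unfolding D_def
  proof (intro finite_UN_I sa(1))
    fix d assume "d \<in> A"
    then show "finite (components (S2 - d))" using two_components by (metis finite.emptyI finite.insertI)
  qed
  have "inj_on sig (cells A)"
  proof (rule inj_onI)
    fix F G assume FG: "F \<in> cells A" "G \<in> cells A" "sig F = sig G"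
    then have comp: "F \<in> components (S2 - \<Union>A)" "G \<in> components (S2 - \<Union>A)" unfolding cells_def by auto
    obtain x y where xy: "x \<in> F" "y \<in> G" using in_components_nonempty comp by blast
    have cc: "connected_component (S2 - d) x y" if d: "d \<in> A" for d
    proof -
      have "F \<subseteq> S2 - d" using in_components_subset[OF comp(1)] d by blast
      then obtain M where M: "M \<in> components (S2 - d)" "F \<subseteq> M"
        using exists_component_superset[of F "S2 - d"] in_components_connected[OF comp(1)] xy(1) by blast
      then have "M \<in> sig F" unfolding sig_def D_def using d by blast
      then have "G \<subseteq> M" using FG(3) unfolding sig_def by blast
      then show ?thesis unfolding connected_component_def
        using M xy in_components_connected[OF M(1)] in_components_subset[OF M(1)] by blast
    qed
    have "insert C (A - {C}) = A" using C_in by blast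
    then have "connected_component (S2 - \<Union>A) x y" using same_cell[of "A - {C}" x y] cc by simp
    then obtain T where "connected T" "T \<subseteq> S2 - \<Union>A" "x \<in> T" "y \<in> T"
      unfolding connected_component_def by blast
    then have "y \<in> F" using components_maximal[OF comp(1), of T] xy(1) by blast
    then show "F = G" using components_nonoverlap[OF comp] xy(2) by blast
  qed
  moreover have "sig ` cells A \<subseteq> Pow D" unfolding sig_def by blast
  ultimately show ?thesis using finD by (metis finite_Pow_iff finite_imageD finite_subset)
qed

lemma card_triangles: "card (triangles A) \<ge> 2 * card A"
proof -
  have fin: "finite (triangles A)" using finite_cells unfolding triangles_def by simp
  define G where "G U = {T. \<exists>F\<in>triangles A. T = closure F \<inter> crossings A \<and> T \<subseteq> U \<union> C \<and> T \<inter> U \<noteq> {}}" for U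
  obtain U W where UW: "U \<noteq> W" "components (S2 - C) = {U, W}" using two_components[OF C_in] by metis
  have disj: "U \<inter> W = {}" "U \<inter> C = {}" "W \<inter> C = {}"
    using UW components_nonoverlap[of U "S2 - C" W] in_components_subset[of U "S2 - C"] in_components_subset[of W "S2 - C"] by auto
  have sub: "G U \<union> G W \<subseteq> (\<lambda>F. closure F \<inter> crossings A) ` triangles A" unfolding G_def by blast
  have finG: "finite (G U)" "finite (G W)" using finite_subset[OF sub] fin by simp_all
  \<comment> \<open>A vertex in \<open>U\<close> cannot belong to a subset of
    \<open>W \<union> C\<close>.\<close>
  have "G U \<inter> G W = {}" unfolding G_def using disj by blast
  then have "card (G U \<union> G W) = card (G U) + card (G W)" using finG by (simp add: card_Un_disjoint)
  moreover have "card (G U \<union> G W) \<le> card (triangles A)" using surj_card_le[OF fin sub] .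
  moreover have "card A \<le> card (G U)" "card A \<le> card (G W)"
    unfolding G_def using triangles_on_side[OF _ fin] UW(2) by blast+
  ultimately show ?thesis by linarith
qed

end

theorem theorem2:
  fixes A :: "(real^3) set set" and C :: "(real^3) set" and n :: nat
  assumes "simple_arrangement A"
    and "pairwise_intersecting A"
    and "card A = n"
    and "n \<ge> 3"
    and "C \<in> A"
    and "\<forall>C'\<in>A. \<forall>C''\<in>A. C' \<noteq> C \<and> C'' \<noteq> C \<and> C' \<noteq> C'' \<longrightarrow>
           (\<forall>p\<in>C' \<inter> C''. \<forall>q\<in>C' \<inter> C''. p \<noteq> q \<longrightarrow>
              (\<exists>U\<in>components (S2 - C). \<exists>W\<in>components (S2 - C). U \<noteq> W \<and> p \<in> U \<and> q \<in> W))"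
  shows "card (triangles A) \<ge> 2 * n"
proof -
  interpret separated_arrangement A C
  proof
    show "simple_arrangement A" "pairwise_intersecting A" "C \<in> A" by fact+
    show "card A \<ge> 3" using assms(3,4) by simp
    show "\<exists>U\<in>components (S2 - C). \<exists>W\<in>components (S2 - C). U \<noteq> W \<and> p \<in> U \<and> q \<in> W"
      if "a \<in> A" "b \<in> A" "a \<noteq> C" "b \<noteq> C" "a \<noteq> b" "p \<in> a \<inter> b" "q \<in> a \<inter> b" "p \<noteq> q" for a b p q
      using assms(6)[rule_format, OF that(1,2) conjI[OF that(3) conjI[OF that(4,5)]] that(6-8)] .
  qed
  show ?thesis using card_triangles assms(3) by simp
qed

end
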